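(* The comonad $(\mathfrak{R},r,\varsigma)$ on $\mathbf{C}$ is a sub-comonad of the comonad $(\mathscr{C},c,\varepsilon)$ on $\mathbf{C}$ via the natural transformation $\beta:\mathfrak{R}\to\mathscr{C}$ (whose components are bijective): for every proximity frame $L$, $$c_L\circ\beta_L=(\beta\circ\beta)_L\circ r_L\quad\text{and}\quad \varepsilon_L\circ\beta_L=\varsigma_L,$$ where $(\beta\circ\beta)_L=\beta_{\mathscr{C}L}\circ\mathfrak{R}(\beta_L):\mathfrak{R}\mathfrak{R}L\to\mathscr{C}\mathscr{C}L$ is the horizontal composite of $\beta$ with itself.
   Context: A proximity on a frame $L$ is a binary relation $\prec$ on $L$ such that: (1) $a\prec b$ implies $a\le b$, and $\prec$ is a (bounded) sublattice of $L\times L$, i.e. $0\prec 0$, $1\prec 1$, and $a_1\prec b_1$, $a_2\prec b_2$ imply $a_1\wedge a_2\prec b_1\wedge b_2$ and $a_1\vee a_2\prec b_1\vee b_2$; (2) $a\le b\prec c\le d$ implies $a\prec d$; (3) $a\prec b$ implies $a\prec c\prec b$ for some $c$; (4) $a=\bigvee\{b\mid b\prec a\}$ for all $a\in L$. The pair $(L,\prec)$ is a proximity frame. $\mathbf{C}$ is the category of proximity frames and frame homomorphisms that preserve the proximities ($a\prec b\Rightarrow f(a)\prec f(b)$). An ideal of $L$ is a downset closed under finite joins (in particular it contains $0$). An ideal $I$ is round if for each $a\in I$ there is $b\in I$ with $a\prec b$. $\mathfrak{R}L$ is the frame of round ideals of $(L,\prec)$ ordered by inclusion (a subframe of the frame of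 ideals of $L$); as an object of $\mathbf{C}$ it carries its way-below relation $\ll$ as proximity ($x\ll y$ iff whenever $y\le\bigvee S$ there is a finite $F\subseteq S$ with $x\le\bigvee F$). For a meet-semilattice homomorphism $f:L\to M$ between proximity frames, $\mathfrak{R}f:\mathfrak{R}L\to\mathfrak{R}M$ is $\mathfrak{R}f(I)=\{a\in M\mid a\prec f(b)\text{ for some }b\in I\}$. $\varsigma_L:\mathfrak{R}L\to L$ is $\varsigma_L(I)=\bigvee I$; $\kappa_L:L\to\mathfrak{R}L$ is $\kappa_L(a)=\{b\mid b\prec a\}$; $r_L=\mathfrak{R}(\kappa_L):\mathfrak{R}L\to\mathfrak{R}\mathfrak{R}L$. The triple $(\mathfrak{R},r,\varsigma)$ is a comonad on $\mathbf{C}$ with comultiplication $r$ and counit $\varsigma$. For a proximity frame $L$, $\mathscr{C}L=(\mathfrak{R}L,\sqsubseteq)$, where $I\sqsubseteq J$ iff $I\subseteq J$ and $I\ll\kappa_L(\varsigma_L(J))$; equivalently, $I\subseteq J$ and $\bigvee I\prec\bigvee J$. This is a proximity on $\mathfrak{R}L$. For $f$ in $\mathbf{C}$, $\mathscr{C}f$ is $\mathfrak{R}f$ as a map $(\mathfrak{R}L,\sqsubseteq)\to(\mathfrak{R}M,\sqsubseteq)$. $\varepsilon_L:\mathscr{C}L\to L$ is $\varepsilon_L(I)=\bigvee I$, and $c_L:\mathscr{C}L\to\mathscr{C}\mathscr{C}L$ is $c_L(I)=\{K\in\mathfrak{R}L\mid K\sqsubseteq\kappa_L(a)\text{ for some }a\in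 I\}$. The triple $(\mathscr{C},c,\varepsilon)$ is a comonad on $\mathbf{C}$ with comultiplication $c$ and counit $\varepsilon$. $\beta_L:(\mathfrak{R}L,\ll)\to(\mathfrak{R}L,\sqsubseteq)$ is the identity on underlying sets, a morphism of $\mathbf{C}$ natural in $L$. *)

theory Defs
  imports "HOL-Algebra.Complete_Lattice"
begin

record 'a pframe = "'a gorder" +
  prox :: "['a, 'a] \<Rightarrow> bool" (infixl \<open>\<prec>\<index>\<close> 50)

locale frame = complete_lattice +
  assumes meet_sup_distrib:
    "\<lbrakk>x \<in> carrier L; A \<subseteq> carrier L\<rbrakk> \<Longrightarrow> x \<sqinter> \<Squnion>A = \<Squnion>((\<lambda>a. x \<sqinter> a) ` A)"

locale proximity_frame = frame L for L :: "'a pframe" (structure) +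
  assumes prox_le:
      "\<lbrakk>a \<in> carrier L; b \<in> carrier L; a \<prec> b\<rbrakk> \<Longrightarrow> a \<sqsubseteq> b"
    and prox_bottom: "\<bottom> \<prec> \<bottom>"
    and prox_top: "\<top> \<prec> \<top>"
    and prox_meet:
      "\<lbrakk>a\<^sub>1 \<in> carrier L; b\<^sub>1 \<in> carrier L; a\<^sub>2 \<in> carrier L; b\<^sub>2 \<in> carrier L; a\<^sub>1 \<prec> b\<^sub>1; a\<^sub>2 \<prec> b\<^sub>2\<rbrakk>
        \<Longrightarrow> (a\<^sub>1 \<sqinter> a\<^sub>2) \<prec> (b\<^sub>1 \<sqinter> b\<^sub>2)"
    and prox_join:
      "\<lbrakk>a\<^sub>1 \<in> carrier L; b\<^sub>1 \<in> carrier L; a\<^sub>2 \<in> carrier L; b\<^sub>2 \<in> carrier L; a\<^sub>1 \<prec> b\<^sub>1; a\<^sub>2 \<prec> b\<^sub>2\<rbrakk>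
        \<Longrightarrow> (a\<^sub>1 \<squnion> a\<^sub>2) \<prec> (b\<^sub>1 \<squnion> b\<^sub>2)"
    and prox_mono:
      "\<lbrakk>a \<in> carrier L; b \<in> carrier L; c \<in> carrier L; d \<in> carrier L; a \<sqsubseteq> b; b \<prec> c; c \<sqsubseteq> d\<rbrakk>
        \<Longrightarrow> a \<prec> d"
    and prox_interpolate:
      "\<lbrakk>a \<in> carrier L; b \<in> carrier L; a \<prec> b\<rbrakk> \<Longrightarrow> \<exists>c\<in>carrier L. a \<prec> c \<and> c \<prec> b"
    and prox_approximate:
      "a \<in> carrier L \<Longrightarrow> a = \<Squnion>{b \<in> carrier L. b \<prec> a}"

text \<open>
  Morphisms are functions on the whole type; only their values on the carrier of the source
  matter, so equality of morphisms is equality on that carrier.  Frame homomorphisms preserve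
  finite meets (including the top element) and arbitrary joins (including the empty one).
\<close>

definition frame_hom :: "('a, 'c) gorder_scheme \<Rightarrow> ('b, 'd) gorder_scheme \<Rightarrow> ('a \<Rightarrow> 'b) set" where
  "frame_hom L M =
     {f \<in> carrier L \<rightarrow> carrier M. f \<top>\<^bsub>L\<^esub> = \<top>\<^bsub>M\<^esub> \<and> meet_pres L M f \<and> sup_pres L M f}"

definition prox_hom :: "'a pframe \<Rightarrow> 'b pframe \<Rightarrow> ('a \<Rightarrow> 'b) set" where
  "prox_hom L M =
     {f \<in> frame_hom L M. \<forall>a\<in>carrier L. \<forall>b\<in>carrier L. a \<prec>\<^bsub>L\<^esub> b \<longrightarrow> f a \<prec>\<^bsub>M\<^esub> f b}"

definition lattice_ideal :: "('a, 'c) gorder_scheme \<Rightarrow> 'a set \<Rightarrow> bool" where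
  "lattice_ideal L I \<longleftrightarrow>
     I \<subseteq> carrier L \<and>
     (\<forall>a\<in>I. \<forall>b\<in>carrier L. b \<sqsubseteq>\<^bsub>L\<^esub> a \<longrightarrow> b \<in> I) \<and>
     (\<forall>F. finite F \<and> F \<subseteq> I \<longrightarrow> \<Squnion>\<^bsub>L\<^esub>F \<in> I)"

definition round_ideal :: "'a pframe \<Rightarrow> 'a set \<Rightarrow> bool" where
  "round_ideal L I \<longleftrightarrow> lattice_ideal L I \<and> (\<forall>a\<in>I. \<exists>b\<in>I. a \<prec>\<^bsub>L\<^esub> b)"

definition way_below :: "('a, 'c) gorder_scheme \<Rightarrow> 'a \<Rightarrow> 'a \<Rightarrow> bool" where
  "way_below L x y \<longleftrightarrow>
     (\<forall>S\<subseteq>carrier L. y \<sqsubseteq>\<^bsub>L\<^esub> \<Squnion>\<^bsub>L\<^esub>S \<longrightarrow> (\<exists>F\<subseteq>S. finite F \<and> x \<sqsubseteq>\<^bsub>L\<^esub> \<Squnion>\<^bsub>L\<^esub>F))"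

definition round_ideals :: "'a pframe \<Rightarrow> 'a set gorder" where
  "round_ideals L = \<lparr>carrier = {I. round_ideal L I}, eq = (=), le = (\<subseteq>)\<rparr>"

definition kappa :: "'a pframe \<Rightarrow> 'a \<Rightarrow> 'a set" where
  "kappa L a = {b \<in> carrier L. b \<prec>\<^bsub>L\<^esub> a}"

definition RR :: "'a pframe \<Rightarrow> 'a set pframe" where
  "RR L = \<lparr>carrier = {I. round_ideal L I}, eq = (=), le = (\<subseteq>),
           prox = way_below (round_ideals L)\<rparr>"

text \<open>The action on a map into \<open>M\<close> depends on the source only through the ideals it is applied to.\<close>

definition RR_map :: "'b pframe \<Rightarrow> ('a \<Rightarrow> 'b) \<Rightarrow> 'a set \<Rightarrow> 'b set" where
  "RR_map M f I = {a \<in> carrier M. \<exists>b\<in>I. a \<prec>\<^bsub>M\<^esub> f b}"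

definition RR_counit :: "'a pframe \<Rightarrow> 'a set \<Rightarrow> 'a" where
  "RR_counit L I = \<Squnion>\<^bsub>L\<^esub>I"

definition RR_comult :: "'a pframe \<Rightarrow> 'a set \<Rightarrow> 'a set set" where
  "RR_comult L = RR_map (RR L) (kappa L)"

definition CC :: "'a pframe \<Rightarrow> 'a set pframe" where
  "CC L = \<lparr>carrier = {I. round_ideal L I}, eq = (=), le = (\<subseteq>),
           prox = (\<lambda>I J. I \<subseteq> J \<and> way_below (round_ideals L) I (kappa L (RR_counit L J)))\<rparr>"

definition CC_map :: "'b pframe \<Rightarrow> ('a \<Rightarrow> 'b) \<Rightarrow> 'a set \<Rightarrow> 'b set" where
  "CC_map M f = RR_map M f"

definition CC_counit :: "'a pframe \<Rightarrow> 'a set \<Rightarrow> 'a" where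
  "CC_counit L I = \<Squnion>\<^bsub>L\<^esub>I"

definition CC_comult :: "'a pframe \<Rightarrow> 'a set \<Rightarrow> 'a set set" where
  "CC_comult L I = {K \<in> carrier (CC L). \<exists>a\<in>I. K \<prec>\<^bsub>CC L\<^esub> kappa L a}"

definition beta :: "'a pframe \<Rightarrow> 'a set \<Rightarrow> 'a set" where
  "beta L = (\<lambda>I\<in>carrier (RR L). I)"

definition beta_beta :: "'a pframe \<Rightarrow> 'a set set \<Rightarrow> 'a set set" where
  "beta_beta L = beta (CC L) \<circ> RR_map (CC L) (beta L)"

end

theory Submission
  imports Defs
begin

text \<open>
  Every round ideal \<open>J\<close> is the directed join of the ideals \<open>kappa L b\<close> with \<open>b \<in> J\<close>. Hence
  \<open>I\<close> is way below \<open>J\<close> iff \<open>\<Squnion>I \<in> J\<close>, and the proximity of \<open>CC L\<close> becomes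
  \<open>I \<subseteq> J \<and> \<Squnion>I \<prec> \<Squnion>J\<close>. With either proximity the comultiplication sends \<open>I\<close> to
  \<open>{K. \<Squnion>K \<in> I}\<close>, so the two comonads have the same underlying frames and maps and differ only in
  the proximities; the comonad laws and the compatibility of \<open>beta\<close> then reduce to elementary
  statements about joins of round ideals.
\<close>

section \<open>Round ideals\<close>

text \<open>The lattice of ideals does not see the proximity put on it:
  \<open>round_ideals L\<close>, \<open>RR L\<close> and \<open>CC L\<close> agree in carrier,
  equality and order, so joins, meets and the way-below relation are computed for any record with
  these three components. Where a proximity does enter a formula, roundness removes it again. For a
  morphism \<open>f\<close>, a bound \<open>a \<sqsubseteq> f b\<close> with
  \<open>b \<in> I\<close> sharpens to \<open>a \<prec> f c\<close> by choosing
  \<open>c \<in> I\<close> with \<open>b \<prec> c\<close>, so images of round ideals can be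
  described by the order alone. In the comultiplication all targets have the form
  \<open>kappa L b\<close>, and there the two proximities agree, both meaning
  \<open>\<Squnion>K \<prec> b\<close>. The obstacle is iteration: the elements of
  \<open>RR (RR L)\<close> and of \<open>CC (CC L)\<close> are ideals subject to two different
  notions of roundness. That the comultiplications take values in the right carriers, and that
  \<open>beta_beta\<close> acts as an inclusion between them, therefore has to be proved.\<close>

lemma (in complete_lattice) sup_mono:
  "\<lbrakk>A \<subseteq> B; B \<subseteq> carrier L\<rbrakk> \<Longrightarrow> \<Squnion>A \<sqsubseteq> \<Squnion>B"
  by (meson order_trans subsetD sup_closed sup_least sup_upper)

lemma (in complete_lattice) sup_empty_eq: "\<Squnion>{} = \<bottom>"
  using weak_sup_empty unfolding eq_is_equal .

lemma (in complete_lattice) sup_carrier_eq: "\<Squnion>(carrier L) = \<top>"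
  using weak_sup_carrier unfolding eq_is_equal .

lemma (in complete_lattice) sup_insert_eq:
  "\<lbrakk>a \<in> carrier L; A \<subseteq> carrier L\<rbrakk> \<Longrightarrow> \<Squnion>(insert a A) = a \<squnion> \<Squnion>A"
  using weak_sup_insert unfolding eq_is_equal .

section \<open>Proximity calculus and membership in round ideals\<close>

context proximity_frame
begin

lemma prox_finite_sup:
  assumes "finite F" "F \<subseteq> carrier L" "g ` F \<subseteq> carrier L" "\<And>x. x \<in> F \<Longrightarrow> x \<prec> g x"
  shows "\<Squnion>F \<prec> \<Squnion>(g ` F)"
  using assms
  by (induction F rule: finite_induct) (simp_all add: sup_empty_eq sup_insert_eq prox_bottom prox_join)

lemma prox_le_trans:
  "\<lbrakk>a \<in> carrier L; b \<in> carrier L; c \<in> carrier L; a \<prec> b; b \<sqsubseteq> c\<rbrakk> \<Longrightarrow> a \<prec> c"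
  using prox_mono[of a a b c] by simp

lemma le_prox_trans:
  "\<lbrakk>a \<in> carrier L; b \<in> carrier L; c \<in> carrier L; a \<sqsubseteq> b; b \<prec> c\<rbrakk> \<Longrightarrow> a \<prec> c"
  using prox_mono[of a b c c] by simp

lemma prox_finite_sup_le:
  assumes "finite F" "F \<subseteq> carrier L" "a \<in> carrier L" "\<And>x. x \<in> F \<Longrightarrow> x \<prec> a"
  shows "\<Squnion>F \<prec> a"
proof -
  have "\<Squnion>F \<prec> \<Squnion>((\<lambda>_. a) ` F)"
    using assms by (intro prox_finite_sup) auto
  \<comment> \<open>Equality may fail here: for empty \<open>F\<close> the image is empty too and
    its join is \<open>\<bottom>\<close> rather than \<open>a\<close>.\<close>
  moreover have "\<Squnion>((\<lambda>_. a) ` F) \<sqsubseteq> a"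
    using assms by (intro sup_least) auto
  ultimately show ?thesis
    using assms(2,3) prox_le_trans[of "\<Squnion>F" "\<Squnion>((\<lambda>_. a) ` F)" a] by (simp add: image_subset_iff)
qed

lemma round_ideal_carrier: "round_ideal L I \<Longrightarrow> I \<subseteq> carrier L"
  by (simp add: round_ideal_def lattice_ideal_def)

lemma round_ideal_memD: "\<lbrakk>round_ideal L I; a \<in> I\<rbrakk> \<Longrightarrow> a \<in> carrier L"
  using round_ideal_carrier by blast

lemma round_ideal_down:
  "\<lbrakk>round_ideal L I; a \<in> I; b \<in> carrier L; b \<sqsubseteq> a\<rbrakk> \<Longrightarrow> b \<in> I"
  by (auto simp: round_ideal_def lattice_ideal_def)

lemma round_ideal_sup: "\<lbrakk>round_ideal L I; finite F; F \<subseteq> I\<rbrakk> \<Longrightarrow> \<Squnion>F \<in> I"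
  by (auto simp: round_ideal_def lattice_ideal_def)

lemma round_ideal_bottom: "round_ideal L I \<Longrightarrow> \<bottom> \<in> I"
  using round_ideal_sup[of I "{}"] by (simp add: sup_empty_eq)

lemma round_ideal_above:
  assumes "round_ideal L I" "a \<in> I"
  obtains b where "b \<in> I" "a \<prec> b"
  using assms by (auto simp: round_ideal_def)

text \<open>Roundness gives one direction; the other holds because \<open>\<prec>\<close> refines
  the order and \<open>I\<close> is a downset. This is what collapses \<open>RR_map L id\<close>
  and, later, the composite of the comultiplication with the image under the counit.\<close>

lemma round_ideal_mem_iff:
  assumes "round_ideal L I" "a \<in> carrier L"
  shows "a \<in> I \<longleftrightarrow> (\<exists>b\<in>I. a \<prec> b)"
  using assms by (meson prox_le round_ideal_above round_ideal_down round_ideal_memD)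

lemma round_idealI:
  assumes "I \<subseteq> carrier L"
    and "\<And>a b. \<lbrakk>a \<in> I; b \<in> carrier L; b \<sqsubseteq> a\<rbrakk> \<Longrightarrow> b \<in> I"
    and "\<And>F. \<lbrakk>finite F; F \<subseteq> I\<rbrakk> \<Longrightarrow> \<Squnion>F \<in> I"
    and "\<And>a. a \<in> I \<Longrightarrow> \<exists>b\<in>I. a \<prec> b"
  shows "round_ideal L I"
  using assms by (auto simp: round_ideal_def lattice_ideal_def)

lemma kappa_mem_iff: "b \<in> kappa L a \<longleftrightarrow> b \<in> carrier L \<and> b \<prec> a"
  by (simp add: kappa_def)

text \<open>The ideal laws are the compatibility of \<open>\<prec>\<close> with the order and with
  finite joins; roundness is interpolation.\<close>

lemma kappa_round:
  assumes a: "a \<in> carrier L"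
  shows "round_ideal L (kappa L a)"
proof (rule round_idealI)
  show "kappa L a \<subseteq> carrier L" by (auto simp: kappa_def)
  show "b \<in> kappa L a" if "c \<in> kappa L a" "b \<in> carrier L" "b \<sqsubseteq> c" for b c
    using that a le_prox_trans[of b c a] by (simp add: kappa_def)
  show "\<Squnion>F \<in> kappa L a" if "finite F" "F \<subseteq> kappa L a" for F
  proof -
    have "F \<subseteq> carrier L" "\<And>x. x \<in> F \<Longrightarrow> x \<prec> a"
      using that(2) by (auto simp: kappa_def)
    then show ?thesis
      using that(1) a by (simp add: kappa_def prox_finite_sup_le)
  qed
  show "\<exists>c\<in>kappa L a. b \<prec> c" if "b \<in> kappa L a" for b
    using that a prox_interpolate[of b a] by (auto simp: kappa_def)
qed

lemma sup_kappa: "a \<in> carrier L \<Longrightarrow> \<Squnion>(kappa L a) = a"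
  using prox_approximate[of a] by (simp add: kappa_def)

lemma kappa_subset:
  assumes "round_ideal L I" "a \<in> I"
  shows "kappa L a \<subseteq> I"
  using assms by (meson kappa_mem_iff prox_le round_ideal_down round_ideal_memD subsetI)

end

section \<open>The round ideal generated by a family of round ideals\<close>

definition ideal_join :: "'a pframe \<Rightarrow> 'a set set \<Rightarrow> 'a set" where
  "ideal_join L S = {a \<in> carrier L. \<exists>F. finite F \<and> F \<subseteq> \<Union>S \<and> a \<sqsubseteq>\<^bsub>L\<^esub> \<Squnion>\<^bsub>L\<^esub>F}"

context proximity_frame
begin

lemma ideal_join_carrier: "ideal_join L S \<subseteq> carrier L"
  by (auto simp: ideal_join_def)

lemma ideal_joinI:
  "\<lbrakk>a \<in> carrier L; finite F; F \<subseteq> \<Union>S; a \<sqsubseteq> \<Squnion>F\<rbrakk> \<Longrightarrow> a \<in> ideal_join L S"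
  by (auto simp: ideal_join_def)

lemma ideal_join_upper:
  assumes "I \<in> S" "round_ideal L I"
  shows "I \<subseteq> ideal_join L S"
proof
  fix a assume a: "a \<in> I"
  then have "a \<in> carrier L" using assms(2) round_ideal_memD by blast
  then show "a \<in> ideal_join L S"
    using a assms(1) by (intro ideal_joinI[of a "{a}"]) auto
qed

lemma ideal_join_least:
  assumes J: "round_ideal L J" and "\<And>I. I \<in> S \<Longrightarrow> I \<subseteq> J"
  shows "ideal_join L S \<subseteq> J"
proof
  fix a assume "a \<in> ideal_join L S"
  then obtain F where F: "a \<in> carrier L" "finite F" "F \<subseteq> \<Union>S" "a \<sqsubseteq> \<Squnion>F"
    by (auto simp: ideal_join_def)
  then have "F \<subseteq> J" using assms(2) by blast
  then show "a \<in> J"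
    using F J round_ideal_sup round_ideal_down by blast
qed

text \<open>Finite subsets of the whole union are taken as generators, so the family need not be
  directed and the empty family yields \<open>{\<bottom>}\<close>. Roundness survives because each
  of the finitely many generators can be raised inside its own member of \<open>S\<close>, and
  \<open>\<prec>\<close> passes to finite joins.\<close>

lemma ideal_join_round:
  assumes S: "\<And>I. I \<in> S \<Longrightarrow> round_ideal L I"
  shows "round_ideal L (ideal_join L S)"
proof (rule round_idealI)
  have SC: "\<Union>S \<subseteq> carrier L" using S round_ideal_carrier by blast
  show "ideal_join L S \<subseteq> carrier L" by (rule ideal_join_carrier)
  show "b \<in> ideal_join L S" if "a \<in> ideal_join L S" "b \<in> carrier L" "b \<sqsubseteq> a" for a b
  proof -
    from that(1) obtain F where F: "a \<in> carrier L" "finite F" "F \<subseteq> \<Union>S" "a \<sqsubseteq> \<Squnion>F"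
      by (auto simp: ideal_join_def)
    moreover have "b \<sqsubseteq> \<Squnion>F"
      using that(2,3) F SC by (meson le_trans order_trans sup_closed)
    ultimately show ?thesis using that(2) ideal_joinI by blast
  qed
  show "\<Squnion>F \<in> ideal_join L S" if F: "finite F" "F \<subseteq> ideal_join L S" for F
  proof -
    have FC: "F \<subseteq> carrier L" using F(2) ideal_join_carrier by blast
    have "\<forall>a\<in>F. \<exists>G. finite G \<and> G \<subseteq> \<Union>S \<and> a \<sqsubseteq> \<Squnion>G"
      using F(2) by (auto simp: ideal_join_def)
    then obtain G where G: "\<And>a. a \<in> F \<Longrightarrow> finite (G a) \<and> G a \<subseteq> \<Union>S \<and> a \<sqsubseteq> \<Squnion>(G a)"
      by metis
    have UG: "\<Union>(G ` F) \<subseteq> \<Union>S" using G by blast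
    then have UC: "\<Union>(G ` F) \<subseteq> carrier L" using SC by blast
    have "\<Squnion>F \<sqsubseteq> \<Squnion>(\<Union>(G ` F))"
    proof (rule sup_least[OF FC])
      show "\<Squnion>(\<Union>(G ` F)) \<in> carrier L" using UC by simp
      fix a assume a: "a \<in> F"
      then have Ga: "G a \<subseteq> \<Union>(G ` F)" by blast
      have "\<Squnion>(G a) \<sqsubseteq> \<Squnion>(\<Union>(G ` F))" by (rule sup_mono[OF Ga UC])
      with G[OF a] Ga UC a FC show "a \<sqsubseteq> \<Squnion>(\<Union>(G ` F))"
        by (meson le_trans order_trans subsetD sup_closed)
    qed
    then show ?thesis
      using G F(1) FC UG by (intro ideal_joinI[of _ "\<Union>(G ` F)"]) auto
  qed
  show "\<exists>b\<in>ideal_join L S. a \<prec> b" if "a \<in> ideal_join L S" for a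
  proof -
    from that obtain F where F: "a \<in> carrier L" "finite F" "F \<subseteq> \<Union>S" "a \<sqsubseteq> \<Squnion>F"
      by (auto simp: ideal_join_def)
    have "\<forall>x\<in>F. \<exists>y\<in>\<Union>S. x \<prec> y"
      using F(3) S by (meson UnionE UnionI round_ideal_above subsetD)
    then obtain g where g: "\<And>x. x \<in> F \<Longrightarrow> g x \<in> \<Union>S \<and> x \<prec> g x" by metis
    then have gS: "g ` F \<subseteq> \<Union>S" by blast
    then have gC: "g ` F \<subseteq> carrier L" using SC by blast
    have FC: "F \<subseteq> carrier L" using F(3) SC by blast
    have "\<Squnion>F \<prec> \<Squnion>(g ` F)"
      using F(2) FC gC g by (intro prox_finite_sup) auto
    then have "a \<prec> \<Squnion>(g ` F)"
      using F(1,4) FC gC le_prox_trans[of a "\<Squnion>F" "\<Squnion>(g ` F)"] by simp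
    moreover have "\<Squnion>(g ` F) \<in> ideal_join L S"
      using F(2) gS gC by (intro ideal_joinI[of _ "g ` F"]) auto
    ultimately show ?thesis by blast
  qed
qed

text \<open>Both sides are the least upper bound of \<open>\<Union>S\<close>: adding finite joins
  and smaller elements does not change the upper bounds. Together with \<open>sup_Int\<close> this
  makes the counit a frame homomorphism.\<close>

lemma sup_ideal_join:
  assumes S: "\<And>I. I \<in> S \<Longrightarrow> round_ideal L I"
  shows "\<Squnion>(ideal_join L S) = \<Squnion>((\<lambda>I. \<Squnion>I) ` S)"
proof (rule le_antisym)
  have IC: "\<And>I. I \<in> S \<Longrightarrow> I \<subseteq> carrier L" using S round_ideal_carrier by blast
  then have sC: "(\<lambda>I. \<Squnion>I) ` S \<subseteq> carrier L" by auto
  show "\<Squnion>(ideal_join L S) \<in> carrier L" "\<Squnion>((\<lambda>I. \<Squnion>I) ` S) \<in> carrier L"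
    using sC ideal_join_carrier by auto
  show "\<Squnion>(ideal_join L S) \<sqsubseteq> \<Squnion>((\<lambda>I. \<Squnion>I) ` S)"
  proof (rule sup_least[OF ideal_join_carrier])
    fix a assume "a \<in> ideal_join L S"
    then obtain F where F: "a \<in> carrier L" "finite F" "F \<subseteq> \<Union>S" "a \<sqsubseteq> \<Squnion>F"
      by (auto simp: ideal_join_def)
    have FC: "F \<subseteq> carrier L" using F(3) IC by blast
    have "\<Squnion>F \<sqsubseteq> \<Squnion>((\<lambda>I. \<Squnion>I) ` S)"
    proof (rule sup_least[OF FC])
      fix x assume "x \<in> F"
      then obtain I where I: "I \<in> S" "x \<in> I" using F(3) by blast
      have "x \<sqsubseteq> \<Squnion>I" by (rule sup_upper[OF IC[OF I(1)] I(2)])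
      moreover have "\<Squnion>I \<sqsubseteq> \<Squnion>((\<lambda>I. \<Squnion>I) ` S)" by (rule sup_upper[OF sC imageI[OF I(1)]])
      ultimately show "x \<sqsubseteq> \<Squnion>((\<lambda>I. \<Squnion>I) ` S)"
        using le_trans[of x "\<Squnion>I"] I IC[OF I(1)] sC by auto
    qed (use sC in simp)
    then show "a \<sqsubseteq> \<Squnion>((\<lambda>I. \<Squnion>I) ` S)"
      using F(1,4) FC sC by (meson le_trans sup_closed)
  qed (use sC in simp)
  show "\<Squnion>((\<lambda>I. \<Squnion>I) ` S) \<sqsubseteq> \<Squnion>(ideal_join L S)"
    using sC S by (intro sup_least) (auto intro: sup_mono[OF ideal_join_upper ideal_join_carrier]
      simp: ideal_join_carrier)
qed

text \<open>Distributing twice turns the meet of the two joins into a join of elements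
  \<open>b \<sqinter> a\<close> with \<open>a \<in> I\<close> and \<open>b \<in> J\<close>, and
  these lie in both downsets.\<close>

lemma sup_Int:
  assumes "round_ideal L I" "round_ideal L J"
  shows "\<Squnion>(I \<inter> J) = \<Squnion>I \<sqinter> \<Squnion>J"
proof (rule le_antisym)
  have C: "I \<subseteq> carrier L" "J \<subseteq> carrier L" "I \<inter> J \<subseteq> carrier L"
    using assms round_ideal_carrier by blast+
  show "\<Squnion>(I \<inter> J) \<in> carrier L" "\<Squnion>I \<sqinter> \<Squnion>J \<in> carrier L" using C by auto
  show "\<Squnion>(I \<inter> J) \<sqsubseteq> \<Squnion>I \<sqinter> \<Squnion>J"
    using C by (intro meet_le sup_mono) auto
  have "\<Squnion>I \<sqinter> \<Squnion>J = \<Squnion>((\<lambda>b. \<Squnion>I \<sqinter> b) ` J)"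
    using C by (intro meet_sup_distrib) auto
  also have "\<dots> \<sqsubseteq> \<Squnion>(I \<inter> J)"
  proof (intro sup_least)
    show "(\<lambda>b. \<Squnion>I \<sqinter> b) ` J \<subseteq> carrier L" "\<Squnion>(I \<inter> J) \<in> carrier L" using C by auto
    fix x assume "x \<in> (\<lambda>b. \<Squnion>I \<sqinter> b) ` J"
    \<comment> \<open>The distributive law expects the join on the right, so the meet is commuted
      before the second use.\<close>
    then obtain b where b: "b \<in> J" "x = b \<sqinter> \<Squnion>I" by (auto simp: meet_comm)
    then have bC: "b \<in> carrier L" using C by blast
    have "x = \<Squnion>((\<lambda>a. b \<sqinter> a) ` I)"
      unfolding b(2) using C bC by (intro meet_sup_distrib) auto
    also have "\<dots> \<sqsubseteq> \<Squnion>(I \<inter> J)"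
    proof (intro sup_mono)
      show "(\<lambda>a. b \<sqinter> a) ` I \<subseteq> I \<inter> J"
      proof
        fix y assume "y \<in> (\<lambda>a. b \<sqinter> a) ` I"
        then obtain a where a: "a \<in> I" "y = b \<sqinter> a" by blast
        then have "a \<in> carrier L" using C by blast
        then show "y \<in> I \<inter> J"
          using a b bC assms
          by (auto intro: round_ideal_down[of I a] round_ideal_down[of J b] meet_left meet_right)
      qed
    qed (use C in simp)
    finally show "x \<sqsubseteq> \<Squnion>(I \<inter> J)" .
  qed
  finally show "\<Squnion>I \<sqinter> \<Squnion>J \<sqsubseteq> \<Squnion>(I \<inter> J)" .
qed

text \<open>An element raised to \<open>b\<close> in \<open>I\<close> and to \<open>c\<close> in
  \<open>J\<close> is raised to \<open>b \<sqinter> c\<close> in both, since \<open>\<prec>\<close>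
  respects binary meets.\<close>

lemma round_ideal_Int:
  assumes "round_ideal L I" "round_ideal L J"
  shows "round_ideal L (I \<inter> J)"
proof (rule round_idealI)
  show "I \<inter> J \<subseteq> carrier L" using assms round_ideal_carrier by blast
  show "b \<in> I \<inter> J" if "a \<in> I \<inter> J" "b \<in> carrier L" "b \<sqsubseteq> a" for a b
    using that assms round_ideal_down by blast
  show "\<Squnion>F \<in> I \<inter> J" if "finite F" "F \<subseteq> I \<inter> J" for F
    using that assms round_ideal_sup by blast
  show "\<exists>b\<in>I \<inter> J. a \<prec> b" if "a \<in> I \<inter> J" for a
  proof -
    from that assms obtain b c where bc: "b \<in> I" "a \<prec> b" "c \<in> J" "a \<prec> c"
      unfolding round_ideal_def by blast
    then have C: "a \<in> carrier L" "b \<in> carrier L" "c \<in> carrier L"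
      using that assms round_ideal_memD by blast+
    have "a \<sqinter> a \<prec> b \<sqinter> c" using bc C by (intro prox_meet) auto
    moreover have "a \<sqinter> a = a" using C le_iff_join[of a a] by simp
    moreover have "b \<sqinter> c \<in> I \<inter> J"
      using bc C assms
      by (auto intro: round_ideal_down[of I b] round_ideal_down[of J c] meet_left meet_right)
    ultimately show ?thesis by auto
  qed
qed

lemma round_ideal_carrier_set: "round_ideal L (carrier L)"
  by (rule round_idealI) (auto intro: prox_top prox_mono[of _ \<top> \<top> \<top>])

lemma round_ideal_singleton_bottom: "round_ideal L {\<bottom>}"
proof (rule round_idealI)
  show "\<Squnion>F \<in> {\<bottom>}" if "finite F" "F \<subseteq> {\<bottom>}" for F
    using that by (auto simp: subset_singleton_iff sup_empty_eq)
qed (auto simp: prox_bottom)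

end

section \<open>The frame of round ideals and its way-below relation\<close>

locale round_ideal_order = proximity_frame L
  for L :: "'a pframe" (structure) +
  fixes R :: "('a set, 'r) gorder_scheme"
  assumes carrier_R: "carrier R = {I. round_ideal L I}"
    and eq_R: "eq R = (=)"
    and le_R: "le R = (\<subseteq>)"
begin

lemma partial_order_R: "partial_order R"
  by unfold_locales (auto simp: eq_R le_R)

lemma is_lub_R:
  assumes "S \<subseteq> carrier R"
  shows "is_lub R (ideal_join L S) S"
proof (rule least_UpperI)
  show "x \<sqsubseteq>\<^bsub>R\<^esub> ideal_join L S" if "x \<in> S" for x
    using that assms ideal_join_upper by (auto simp: le_R carrier_R)
  show "ideal_join L S \<sqsubseteq>\<^bsub>R\<^esub> y" if "y \<in> Upper R S" for y
    using that assms ideal_join_least[of y S] by (auto simp: le_R carrier_R Upper_def)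
  show "ideal_join L S \<in> carrier R"
    using assms ideal_join_round by (auto simp: carrier_R)
qed (rule assms)

text \<open>\<open>\<Squnion>\<close> is an indefinite choice among least upper bounds; antisymmetry
  leaves only one candidate.\<close>

lemma sup_R:
  assumes "S \<subseteq> carrier R"
  shows "\<Squnion>\<^bsub>R\<^esub>S = ideal_join L S"
  unfolding sup_def
proof (rule some_equality)
  show "is_lub R (ideal_join L S) S" by (rule is_lub_R[OF assms])
  show "J = ideal_join L S" if "is_lub R J S" for J
    by (rule partial_order.least_unique[OF partial_order_R that is_lub_R[OF assms]])
qed

lemma complete_lattice_R: "complete_lattice R"
proof -
  interpret R: partial_order R by (rule partial_order_R)
  show ?thesis
  proof
    fix A assume A: "A \<subseteq> carrier R"
    then show "\<exists>s. is_lub R s A" using is_lub_R by blast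
    \<comment> \<open>Infima are built as joins of all lower bounds, because an infinite
      intersection of round ideals need not be round.\<close>
    let ?B = "Lower R A"
    have B: "?B \<subseteq> carrier R" by simp
    have "greatest R (ideal_join L ?B) ?B"
      unfolding greatest_def
    proof (intro conjI ballI)
      show "ideal_join L ?B \<in> ?B"
      proof (rule Lower_memI)
        show "ideal_join L ?B \<in> carrier R" using is_lub_R[OF B] by simp
        show "ideal_join L ?B \<sqsubseteq>\<^bsub>R\<^esub> y" if "y \<in> A" for y
          using that A by (intro least_le[OF is_lub_R[OF B]] Upper_memI) (auto simp: Lower_def)
      qed
      show "x \<sqsubseteq>\<^bsub>R\<^esub> ideal_join L ?B" if "x \<in> ?B" for x
        using least_Upper_above[OF is_lub_R[OF B] that B] .
    qed (rule B)
    then show "\<exists>s. is_glb R s A" by blast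
  qed
qed

lemma meet_R:
  assumes "I \<in> carrier R" "J \<in> carrier R"
  shows "I \<sqinter>\<^bsub>R\<^esub> J = I \<inter> J"
proof -
  interpret R: complete_lattice R by (rule complete_lattice_R)
  have IJ: "I \<inter> J \<in> carrier R" using assms round_ideal_Int by (simp add: carrier_R)
  show ?thesis
    using R.meet_left[OF assms] R.meet_right[OF assms] R.meet_le[OF _ _ assms IJ]
    by (auto simp: le_R)
qed

lemma join_R:
  assumes "I \<in> carrier R" "J \<in> carrier R"
  shows "I \<squnion>\<^bsub>R\<^esub> J = ideal_join L {I, J}"
  unfolding join_def using assms by (intro sup_R) auto

lemma top_R: "\<top>\<^bsub>R\<^esub> = carrier L"
proof -
  interpret R: complete_lattice R by (rule complete_lattice_R)
  have "carrier L \<in> carrier R" by (simp add: carrier_R round_ideal_carrier_set)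
  then show ?thesis
    using R.top_higher R.top_closed round_ideal_carrier[of "\<top>\<^bsub>R\<^esub>"] by (simp add: le_R carrier_R subset_antisym)
qed

lemma bottom_R: "\<bottom>\<^bsub>R\<^esub> = {\<bottom>}"
proof -
  interpret R: complete_lattice R by (rule complete_lattice_R)
  have "{\<bottom>} \<in> carrier R" by (simp add: carrier_R round_ideal_singleton_bottom)
  then have "\<bottom>\<^bsub>R\<^esub> \<subseteq> {\<bottom>}"
    using R.bottom_lower by (simp add: le_R)
  moreover have "\<bottom> \<in> \<bottom>\<^bsub>R\<^esub>"
    using R.bottom_closed round_ideal_bottom by (simp add: carrier_R)
  ultimately show ?thesis by blast
qed

text \<open>An element \<open>x\<close> of \<open>I\<close> below \<open>\<Squnion>F\<close> is the
  join of the finitely many \<open>x \<sqinter> a\<close> with \<open>a \<in> F\<close>. Each of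
  them lies in the intersection of \<open>I\<close> with a member of the family, so these are
  generators for the join of the intersections.\<close>

lemma frame_R: "frame R"
proof -
  interpret R: complete_lattice R by (rule complete_lattice_R)
  show ?thesis
  proof
    fix I A assume I: "I \<in> carrier R" and A: "A \<subseteq> carrier R"
    let ?B = "(\<lambda>J. I \<sqinter>\<^bsub>R\<^esub> J) ` A"
    have B: "?B \<subseteq> carrier R" using I A by auto
    have "I \<inter> ideal_join L A \<subseteq> ideal_join L ?B"
    proof
      fix x assume x: "x \<in> I \<inter> ideal_join L A"
      then obtain F where F: "x \<in> carrier L" "finite F" "F \<subseteq> \<Union>A" "x \<sqsubseteq> \<Squnion>F"
        by (auto simp: ideal_join_def)
      have FC: "F \<subseteq> carrier L" using F(3) A round_ideal_carrier by (fastforce simp: carrier_R)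
      have "x = x \<sqinter> \<Squnion>F" using F FC le_iff_join[of x "\<Squnion>F"] by simp
      also have "\<dots> = \<Squnion>((\<lambda>a. x \<sqinter> a) ` F)" using F FC by (intro meet_sup_distrib)
      finally have "x = \<Squnion>((\<lambda>a. x \<sqinter> a) ` F)" .
      moreover have "(\<lambda>a. x \<sqinter> a) ` F \<subseteq> \<Union>?B"
      proof
        fix y assume "y \<in> (\<lambda>a. x \<sqinter> a) ` F"
        then obtain a J where a: "y = x \<sqinter> a" "a \<in> F" "a \<in> J" "J \<in> A" using F(3) by blast
        then have aC: "a \<in> carrier L" "round_ideal L J" "round_ideal L I" "J \<in> carrier R"
          using FC A I by (auto simp: carrier_R)
        have "y \<in> I \<inter> J"
          using a aC x F(1)
          by (auto intro: round_ideal_down[of I x] round_ideal_down[of J a] meet_left meet_right)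
        then show "y \<in> \<Union>?B" using a(4) meet_R[OF I aC(4)] by blast
      qed
      ultimately show "x \<in> ideal_join L ?B"
        using F(1,2) by (intro ideal_joinI[of x "(\<lambda>a. x \<sqinter> a) ` F"]) auto
    qed
    moreover have "ideal_join L ?B \<subseteq> I \<inter> ideal_join L A"
    proof (rule ideal_join_least)
      show "round_ideal L (I \<inter> ideal_join L A)"
        using I A by (auto simp: carrier_R intro!: round_ideal_Int ideal_join_round)
      fix K assume "K \<in> ?B"
      then obtain J where J: "J \<in> A" "K = I \<inter> J" using meet_R[OF I] A by auto
      then show "K \<subseteq> I \<inter> ideal_join L A"
        using ideal_join_upper[of J A] A by (auto simp: carrier_R)
    qed
    ultimately have "I \<inter> ideal_join L A = ideal_join L ?B" by (rule subset_antisym)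
    then show "I \<sqinter>\<^bsub>R\<^esub> \<Squnion>\<^bsub>R\<^esub>A = \<Squnion>\<^bsub>R\<^esub>?B"
      using meet_R[OF I R.sup_closed[OF A]] A B by (simp add: sup_R)
  qed
qed

text \<open>One direction tests the relation on the cover of \<open>J\<close> by the ideals
  \<open>kappa L b\<close>: finitely many of them have a join of the form \<open>\<Squnion>G\<close>
  with finite \<open>G \<subseteq> J\<close>, which bounds \<open>\<Squnion>I\<close>. For the
  other, membership of the single element \<open>\<Squnion>I\<close> in a generated ideal uses
  finitely many generators, hence finitely many members of the family.\<close>

lemma way_below_R:
  assumes I: "I \<in> carrier R" and J: "J \<in> carrier R"
  shows "way_below R I J \<longleftrightarrow> \<Squnion>I \<in> J"
proof
  have IC: "I \<subseteq> carrier L" and rJ: "round_ideal L J"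
    using I J round_ideal_carrier by (auto simp: carrier_R)
  show "\<Squnion>I \<in> J" if wb: "way_below R I J"
  proof -
    let ?S = "kappa L ` J"
    have S: "?S \<subseteq> carrier R"
      using rJ by (auto simp: carrier_R intro: kappa_round round_ideal_memD)
    have "J \<subseteq> ideal_join L ?S"
    proof
      fix a assume a: "a \<in> J"
      then obtain b where b: "b \<in> J" "a \<prec> b" using rJ round_ideal_above by blast
      have "a \<in> kappa L b" using a b rJ round_ideal_memD by (simp add: kappa_mem_iff)
      then show "a \<in> ideal_join L ?S"
        using b(1) S ideal_join_upper[of "kappa L b" ?S] by (auto simp: carrier_R)
    qed
    then obtain F where F: "F \<subseteq> ?S" "finite F" "I \<sqsubseteq>\<^bsub>R\<^esub> \<Squnion>\<^bsub>R\<^esub>F"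
      using wb S unfolding way_below_def by (metis le_R sup_R)
    then obtain G where G: "finite G" "G \<subseteq> J" "F = kappa L ` G"
      by (meson finite_subset_image)
    have GC: "G \<subseteq> carrier L" using G(2) rJ round_ideal_carrier by blast
    have FR: "F \<subseteq> carrier R" using F(1) S by blast
    have "\<Squnion>I \<sqsubseteq> \<Squnion>(ideal_join L F)"
      using F(3) FR by (intro sup_mono ideal_join_carrier) (simp add: le_R sup_R)
    also have "\<Squnion>(ideal_join L F) = \<Squnion>((\<lambda>I. \<Squnion>I) ` F)"
      using FR by (intro sup_ideal_join) (auto simp: carrier_R)
    also have "(\<lambda>I. \<Squnion>I) ` F = G"
      unfolding G(3) image_image using GC sup_kappa by (auto simp: subset_iff image_iff)
    finally have "\<Squnion>I \<sqsubseteq> \<Squnion>G" .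
    then show ?thesis
      using rJ G IC round_ideal_sup[of J G] round_ideal_down[of J "\<Squnion>G" "\<Squnion>I"] by simp
  qed
  show "way_below R I J" if s: "\<Squnion>I \<in> J"
    unfolding way_below_def
  proof (intro allI impI)
    fix S assume S: "S \<subseteq> carrier R" and "J \<sqsubseteq>\<^bsub>R\<^esub> \<Squnion>\<^bsub>R\<^esub>S"
    then have "\<Squnion>I \<in> ideal_join L S" using s by (auto simp: le_R sup_R)
    then obtain F where F: "finite F" "F \<subseteq> \<Union>S" "\<Squnion>I \<sqsubseteq> \<Squnion>F"
      by (auto simp: ideal_join_def)
    then obtain T where T: "T \<subseteq> S" "finite T" "F \<subseteq> \<Union>T"
      by (meson finite_subset_Union)
    have TR: "T \<subseteq> carrier R" using T(1) S by blast
    have FC: "F \<subseteq> carrier L" using F(2) S round_ideal_carrier by (fastforce simp: carrier_R)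
    have "I \<subseteq> ideal_join L T"
    proof
      fix x assume x: "x \<in> I"
      then have xC: "x \<in> carrier L" using IC by blast
      have "x \<sqsubseteq> \<Squnion>F"
        using sup_upper[OF IC x] F(3) xC IC FC by (meson le_trans sup_closed)
      then show "x \<in> ideal_join L T" using xC F(1) T(3) ideal_joinI by blast
    qed
    then show "\<exists>F\<subseteq>S. finite F \<and> I \<sqsubseteq>\<^bsub>R\<^esub> \<Squnion>\<^bsub>R\<^esub>F"
      using T TR by (metis le_R sup_R)
  qed
qed

end

section \<open>The action on morphisms\<close>

text \<open>\<open>meet_pres\<close> and \<open>sup_pres\<close> include the lattice properties of
  source and target in their definitions, whence the first two premises.\<close>

lemma frame_homI:
  assumes "complete_lattice L" "complete_lattice M"
    and "\<And>a. a \<in> carrier L \<Longrightarrow> f a \<in> carrier M"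
    and "f \<top>\<^bsub>L\<^esub> = \<top>\<^bsub>M\<^esub>"
    and "\<And>a b. \<lbrakk>a \<in> carrier L; b \<in> carrier L\<rbrakk> \<Longrightarrow> f (a \<sqinter>\<^bsub>L\<^esub> b) = f a \<sqinter>\<^bsub>M\<^esub> f b"
    and "\<And>A. A \<subseteq> carrier L \<Longrightarrow> f (\<Squnion>\<^bsub>L\<^esub>A) = \<Squnion>\<^bsub>M\<^esub>(f ` A)"
  shows "f \<in> frame_hom L M"
proof -
  interpret L: complete_lattice L by fact
  interpret M: complete_lattice M by fact
  show ?thesis
    using assms L.lattice_axioms M.lattice_axioms
    by (simp add: frame_hom_def meet_pres_def sup_pres_def)
qed

lemma prox_homI:
  assumes "f \<in> frame_hom L M"
    and "\<And>a b. \<lbrakk>a \<in> carrier L; b \<in> carrier L; a \<prec>\<^bsub>L\<^esub> b\<rbrakk> \<Longrightarrow> f a \<prec>\<^bsub>M\<^esub> f b"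
  shows "f \<in> prox_hom L M"
  using assms by (simp add: prox_hom_def)

lemma prox_hom_compose:
  assumes f: "f \<in> prox_hom L M" and g: "g \<in> prox_hom M N"
  shows "g \<circ> f \<in> prox_hom L N"
proof -
  have fC: "f a \<in> carrier M" if "a \<in> carrier L" for a
    using f that by (auto simp: prox_hom_def frame_hom_def)
  then have fA: "f ` A \<subseteq> carrier M" if "A \<subseteq> carrier L" for A using that by blast
  have "g \<circ> f \<in> frame_hom L N"
  proof (rule frame_homI)
    show "complete_lattice L" "complete_lattice N"
      using f g by (auto simp: prox_hom_def frame_hom_def sup_pres_def)
    show "(g \<circ> f) a \<in> carrier N" if "a \<in> carrier L" for a
      using g fC[OF that] by (auto simp: prox_hom_def frame_hom_def)
    show "(g \<circ> f) \<top>\<^bsub>L\<^esub> = \<top>\<^bsub>N\<^esub>"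
      using f g by (simp add: prox_hom_def frame_hom_def)
    show "(g \<circ> f) (a \<sqinter>\<^bsub>L\<^esub> b) = (g \<circ> f) a \<sqinter>\<^bsub>N\<^esub> (g \<circ> f) b"
      if "a \<in> carrier L" "b \<in> carrier L" for a b
      using f g that fC by (simp add: prox_hom_def frame_hom_def meet_pres_def)
    show "(g \<circ> f) (\<Squnion>\<^bsub>L\<^esub>A) = \<Squnion>\<^bsub>N\<^esub>((g \<circ> f) ` A)" if "A \<subseteq> carrier L" for A
      using f g that fA[OF that] by (simp add: prox_hom_def frame_hom_def sup_pres_def image_comp)
  qed
  then show ?thesis
  proof (rule prox_homI)
    show "(g \<circ> f) a \<prec>\<^bsub>N\<^esub> (g \<circ> f) b" if "a \<in> carrier L" "b \<in> carrier L" "a \<prec>\<^bsub>L\<^esub> b" for a b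
      using f g that fC by (simp add: prox_hom_def)
  qed
qed

section \<open>Images of round ideals under a proximity homomorphism\<close>

locale proximity_hom = proximity_frame L + M: proximity_frame M
  for L :: "'a pframe" (structure) and M :: "'b pframe" and f :: "'a \<Rightarrow> 'b" +
  assumes hom: "f \<in> prox_hom L M"
begin

lemma hom_closed: "a \<in> carrier L \<Longrightarrow> f a \<in> carrier M"
  using hom by (auto simp: prox_hom_def frame_hom_def)

lemma hom_image: "A \<subseteq> carrier L \<Longrightarrow> f ` A \<subseteq> carrier M"
  using hom_closed by blast

lemma hom_meet: "\<lbrakk>a \<in> carrier L; b \<in> carrier L\<rbrakk> \<Longrightarrow> f (a \<sqinter> b) = f a \<sqinter>\<^bsub>M\<^esub> f b"
  using hom by (auto simp: prox_hom_def frame_hom_def meet_pres_def)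

lemma hom_sup: "A \<subseteq> carrier L \<Longrightarrow> f (\<Squnion>A) = \<Squnion>\<^bsub>M\<^esub>(f ` A)"
  using hom by (auto simp: prox_hom_def frame_hom_def sup_pres_def)

lemma hom_top: "f \<top> = \<top>\<^bsub>M\<^esub>"
  using hom by (auto simp: prox_hom_def frame_hom_def)

lemma hom_prox: "\<lbrakk>a \<in> carrier L; b \<in> carrier L; a \<prec> b\<rbrakk> \<Longrightarrow> f a \<prec>\<^bsub>M\<^esub> f b"
  using hom by (auto simp: prox_hom_def)

lemma hom_le: "\<lbrakk>a \<in> carrier L; b \<in> carrier L; a \<sqsubseteq> b\<rbrakk> \<Longrightarrow> f a \<sqsubseteq>\<^bsub>M\<^esub> f b"
  by (metis hom_meet hom_closed le_iff_join M.le_iff_join)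

text \<open>Replacing \<open>\<prec>\<close> by the order uses that \<open>I\<close> is round and \<open>f\<close> preserves the proximity.\<close>
lemma RR_map_eq:
  assumes I: "round_ideal L I"
  shows "RR_map M f I = {a \<in> carrier M. \<exists>b\<in>I. a \<sqsubseteq>\<^bsub>M\<^esub> f b}"
proof -
  have "(\<exists>b\<in>I. a \<prec>\<^bsub>M\<^esub> f b) \<longleftrightarrow> (\<exists>b\<in>I. a \<sqsubseteq>\<^bsub>M\<^esub> f b)" if a: "a \<in> carrier M" for a
  proof
    assume "\<exists>b\<in>I. a \<prec>\<^bsub>M\<^esub> f b"
    then show "\<exists>b\<in>I. a \<sqsubseteq>\<^bsub>M\<^esub> f b"
      using a I M.prox_le hom_closed round_ideal_memD by meson
  next
    assume "\<exists>b\<in>I. a \<sqsubseteq>\<^bsub>M\<^esub> f b"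
    then obtain b where b: "b \<in> I" "a \<sqsubseteq>\<^bsub>M\<^esub> f b" by blast
    then obtain c where c: "c \<in> I" "b \<prec> c" using I round_ideal_above by blast
    have C: "b \<in> carrier L" "c \<in> carrier L" using b c I round_ideal_memD by blast+
    have "a \<prec>\<^bsub>M\<^esub> f c"
      using M.le_prox_trans[of a "f b" "f c"] a b C c(2) hom_closed hom_prox by blast
    then show "\<exists>b\<in>I. a \<prec>\<^bsub>M\<^esub> f b" using c by blast
  qed
  then show ?thesis unfolding RR_map_def by blast
qed

lemma RR_map_memI:
  "\<lbrakk>round_ideal L I; b \<in> I; a \<in> carrier M; a \<sqsubseteq>\<^bsub>M\<^esub> f b\<rbrakk> \<Longrightarrow> a \<in> RR_map M f I"
  by (auto simp: RR_map_eq)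

lemma RR_map_memE:
  assumes "a \<in> RR_map M f I" "round_ideal L I"
  obtains b where "b \<in> I" "a \<sqsubseteq>\<^bsub>M\<^esub> f b" "a \<in> carrier M" "b \<in> carrier L" "f b \<in> carrier M"
  using assms by (auto simp: RR_map_eq intro: round_ideal_memD hom_closed)

lemma RR_map_image: "\<lbrakk>round_ideal L I; b \<in> I\<rbrakk> \<Longrightarrow> f b \<in> RR_map M f I"
  using hom_closed round_ideal_memD by (intro RR_map_memI) auto

lemma RR_map_carrier: "RR_map M f I \<subseteq> carrier M"
  by (auto simp: RR_map_def)

text \<open>The description by the order serves for the ideal laws and the one by
  \<open>\<prec>\<close> for roundness: a member \<open>a \<prec> f b\<close> has \<open>f b\<close>
  itself above it in the image.\<close>

lemma RR_map_round:
  assumes I: "round_ideal L I"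
  shows "round_ideal M (RR_map M f I)"
proof (rule M.round_idealI)
  show "RR_map M f I \<subseteq> carrier M" by (rule RR_map_carrier)
  show "b \<in> RR_map M f I" if "a \<in> RR_map M f I" "b \<in> carrier M" "b \<sqsubseteq>\<^bsub>M\<^esub> a" for a b
    using that(1) I
  proof (rule RR_map_memE)
    fix c assume c: "c \<in> I" "a \<sqsubseteq>\<^bsub>M\<^esub> f c" "a \<in> carrier M" "f c \<in> carrier M"
    then show ?thesis
      using M.le_trans[of b a "f c"] that I by (intro RR_map_memI) auto
  qed
  show "\<Squnion>\<^bsub>M\<^esub>F \<in> RR_map M f I" if F: "finite F" "F \<subseteq> RR_map M f I" for F
  proof -
    have FC: "F \<subseteq> carrier M" using F(2) RR_map_carrier by blast
    have "\<forall>a\<in>F. \<exists>b\<in>I. a \<sqsubseteq>\<^bsub>M\<^esub> f b" using F(2) I by (auto simp: RR_map_eq)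
    then obtain g where g: "\<And>a. a \<in> F \<Longrightarrow> g a \<in> I \<and> a \<sqsubseteq>\<^bsub>M\<^esub> f (g a)" by metis
    have gI: "g ` F \<subseteq> I" using g by blast
    then have gC: "g ` F \<subseteq> carrier L" using I round_ideal_carrier by blast
    have "\<Squnion>\<^bsub>M\<^esub>F \<sqsubseteq>\<^bsub>M\<^esub> \<Squnion>\<^bsub>M\<^esub>(f ` g ` F)"
    proof (rule M.sup_least[OF FC])
      show "\<Squnion>\<^bsub>M\<^esub>(f ` g ` F) \<in> carrier M" using hom_image[OF gC] by simp
      fix a assume a: "a \<in> F"
      then have fg: "f (g a) \<in> f ` g ` F" by blast
      show "a \<sqsubseteq>\<^bsub>M\<^esub> \<Squnion>\<^bsub>M\<^esub>(f ` g ` F)"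
        using M.le_trans[of a "f (g a)" "\<Squnion>\<^bsub>M\<^esub>(f ` g ` F)"] g[OF a] a FC
          M.sup_upper[OF hom_image[OF gC] fg] hom_image[OF gC] fg M.sup_closed
        by blast
    qed
    then have "\<Squnion>\<^bsub>M\<^esub>F \<sqsubseteq>\<^bsub>M\<^esub> f (\<Squnion>(g ` F))" by (simp add: hom_sup[OF gC])
    then show ?thesis
      using I F(1) FC gI round_ideal_sup[of I "g ` F"] by (intro RR_map_memI) auto
  qed
  show "\<exists>b\<in>RR_map M f I. a \<prec>\<^bsub>M\<^esub> b" if "a \<in> RR_map M f I" for a
  proof -
    from that obtain b where "b \<in> I" "a \<prec>\<^bsub>M\<^esub> f b" by (auto simp: RR_map_def)
    then show ?thesis using RR_map_image[OF I] by blast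
  qed
qed

text \<open>This is naturality of the counit. The elements \<open>f b\<close> with
  \<open>b \<in> I\<close> belong to the image ideal and are cofinal in it, and \<open>f\<close>
  preserves joins.\<close>

lemma sup_RR_map:
  assumes I: "round_ideal L I"
  shows "\<Squnion>\<^bsub>M\<^esub>(RR_map M f I) = f (\<Squnion>I)"
proof (rule M.le_antisym)
  have IC: "I \<subseteq> carrier L" using I round_ideal_carrier by blast
  show C: "\<Squnion>\<^bsub>M\<^esub>(RR_map M f I) \<in> carrier M" "f (\<Squnion>I) \<in> carrier M"
    using IC hom_closed RR_map_carrier by auto
  show "\<Squnion>\<^bsub>M\<^esub>(RR_map M f I) \<sqsubseteq>\<^bsub>M\<^esub> f (\<Squnion>I)"
  proof (rule M.sup_least[OF RR_map_carrier C(2)])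
    fix a assume "a \<in> RR_map M f I"
    then obtain b where b: "b \<in> I" "a \<sqsubseteq>\<^bsub>M\<^esub> f b" "a \<in> carrier M" "b \<in> carrier L" "f b \<in> carrier M"
      using I RR_map_memE by blast
    moreover have "f b \<sqsubseteq>\<^bsub>M\<^esub> f (\<Squnion>I)"
      using b IC by (intro hom_le sup_upper) auto
    ultimately show "a \<sqsubseteq>\<^bsub>M\<^esub> f (\<Squnion>I)" using C(2) M.le_trans by blast
  qed
  show "f (\<Squnion>I) \<sqsubseteq>\<^bsub>M\<^esub> \<Squnion>\<^bsub>M\<^esub>(RR_map M f I)"
    unfolding hom_sup[OF IC]
    using I RR_map_image by (intro M.sup_mono RR_map_carrier) auto
qed

lemma RR_map_Int:
  assumes I: "round_ideal L I" and J: "round_ideal L J"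
  shows "RR_map M f (I \<inter> J) = RR_map M f I \<inter> RR_map M f J"
proof
  show "RR_map M f (I \<inter> J) \<subseteq> RR_map M f I \<inter> RR_map M f J" by (auto simp: RR_map_def)
  show "RR_map M f I \<inter> RR_map M f J \<subseteq> RR_map M f (I \<inter> J)"
  proof
    fix a assume "a \<in> RR_map M f I \<inter> RR_map M f J"
    then obtain b c where bc: "a \<in> carrier M" "b \<in> I" "a \<sqsubseteq>\<^bsub>M\<^esub> f b" "c \<in> J" "a \<sqsubseteq>\<^bsub>M\<^esub> f c"
      by (auto simp: RR_map_eq I J)
    then have C: "b \<in> carrier L" "c \<in> carrier L" using I J round_ideal_memD by blast+
    have "b \<sqinter> c \<in> I \<inter> J"
      using bc C I J
      by (auto intro: round_ideal_down[of I b] round_ideal_down[of J c] meet_left meet_right)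
    moreover have "a \<sqsubseteq>\<^bsub>M\<^esub> f (b \<sqinter> c)"
      using bc C hom_closed by (simp add: hom_meet M.meet_le)
    ultimately show "a \<in> RR_map M f (I \<inter> J)"
      using bc(1) round_ideal_Int[OF I J] by (intro RR_map_memI)
  qed
qed

lemma RR_map_top: "RR_map M f (carrier L) = carrier M"
proof -
  have "a \<in> RR_map M f (carrier L)" if "a \<in> carrier M" for a
    using that hom_top round_ideal_carrier_set by (intro RR_map_memI[of _ \<top>]) auto
  then show ?thesis using RR_map_carrier by blast
qed

text \<open>A finite set generating a bound for \<open>b\<close> is carried by \<open>f\<close> to a
  finite set generating a bound for \<open>f b\<close>, because \<open>f\<close> preserves its
  join.\<close>

lemma RR_map_ideal_join:
  assumes S: "\<And>I. I \<in> S \<Longrightarrow> round_ideal L I"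
  shows "RR_map M f (ideal_join L S) = ideal_join M (RR_map M f ` S)"
proof
  have SC: "\<Union>S \<subseteq> carrier L" using S round_ideal_carrier by blast
  show "RR_map M f (ideal_join L S) \<subseteq> ideal_join M (RR_map M f ` S)"
  proof
    fix a assume "a \<in> RR_map M f (ideal_join L S)"
    then obtain b where b: "b \<in> ideal_join L S" "a \<sqsubseteq>\<^bsub>M\<^esub> f b" "a \<in> carrier M" "b \<in> carrier L"
        "f b \<in> carrier M"
      using ideal_join_round[OF S] RR_map_memE by blast
    then obtain F where F: "finite F" "F \<subseteq> \<Union>S" "b \<sqsubseteq> \<Squnion>F" by (auto simp: ideal_join_def)
    have FC: "F \<subseteq> carrier L" using F(2) SC by blast
    have "f b \<sqsubseteq>\<^bsub>M\<^esub> \<Squnion>\<^bsub>M\<^esub>(f ` F)"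
      using hom_le[of b "\<Squnion>F"] b F FC by (simp add: hom_sup)
    then have "a \<sqsubseteq>\<^bsub>M\<^esub> \<Squnion>\<^bsub>M\<^esub>(f ` F)"
      using M.le_trans[of a "f b"] b hom_image[OF FC] by simp
    moreover have "f ` F \<subseteq> \<Union>(RR_map M f ` S)" using F(2) S RR_map_image by blast
    ultimately show "a \<in> ideal_join M (RR_map M f ` S)"
      using b(3) F(1) by (intro M.ideal_joinI[of _ "f ` F"]) auto
  qed
  show "ideal_join M (RR_map M f ` S) \<subseteq> RR_map M f (ideal_join L S)"
  proof (rule M.ideal_join_least)
    show "round_ideal M (RR_map M f (ideal_join L S))"
      by (intro RR_map_round ideal_join_round S)
    fix J assume "J \<in> RR_map M f ` S"
    then show "J \<subseteq> RR_map M f (ideal_join L S)"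
      using S ideal_join_upper by (fastforce simp: RR_map_def)
  qed
qed

lemma RR_map_frame_hom:
  assumes "round_ideal_order L R" "round_ideal_order M R'"
  shows "RR_map M f \<in> frame_hom R R'"
proof -
  interpret R: round_ideal_order L R by fact
  interpret R': round_ideal_order M R' by fact
  show ?thesis
  proof (rule frame_homI[OF R.complete_lattice_R R'.complete_lattice_R])
    show closed: "RR_map M f I \<in> carrier R'" if "I \<in> carrier R" for I
      using that RR_map_round by (simp add: R.carrier_R R'.carrier_R)
    show "RR_map M f \<top>\<^bsub>R\<^esub> = \<top>\<^bsub>R'\<^esub>" by (simp add: R.top_R R'.top_R RR_map_top)
    show "RR_map M f (I \<sqinter>\<^bsub>R\<^esub> J) = RR_map M f I \<sqinter>\<^bsub>R'\<^esub> RR_map M f J"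
      if "I \<in> carrier R" "J \<in> carrier R" for I J
      using that RR_map_Int closed by (simp add: R.meet_R R'.meet_R R.carrier_R)
    show "RR_map M f (\<Squnion>\<^bsub>R\<^esub>S) = \<Squnion>\<^bsub>R'\<^esub>(RR_map M f ` S)" if S: "S \<subseteq> carrier R" for S
    proof -
      have "RR_map M f ` S \<subseteq> carrier R'" using S closed by blast
      moreover have "\<And>I. I \<in> S \<Longrightarrow> round_ideal L I" using S by (auto simp: R.carrier_R)
      ultimately show ?thesis using S by (simp add: R.sup_R R'.sup_R RR_map_ideal_join)
    qed
  qed
qed

end

section \<open>Identity and composition laws\<close>

lemma RR_map_id:
  assumes "proximity_frame L" "round_ideal L I"
  shows "RR_map L id I = I"
proof -
  interpret proximity_frame L by fact
  show ?thesis
    using round_ideal_mem_iff[OF assms(2)] round_ideal_memD[OF assms(2)]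
    unfolding RR_map_def id_def by blast
qed

lemma RR_map_compose:
  assumes "proximity_hom L M f" "proximity_hom M N g" "round_ideal L I"
  shows "RR_map N (g \<circ> f) I = RR_map N g (RR_map M f I)"
proof -
  interpret f: proximity_hom L M f by fact
  interpret g: proximity_hom M N g by fact
  interpret gf: proximity_hom L N "g \<circ> f"
    by unfold_locales (rule prox_hom_compose[OF f.hom g.hom])
  have I: "round_ideal L I" and J: "round_ideal M (RR_map M f I)"
    using assms(3) f.RR_map_round by auto
  show ?thesis
  proof (intro subset_antisym subsetI)
    fix a assume "a \<in> RR_map N (g \<circ> f) I"
    then show "a \<in> RR_map N g (RR_map M f I)"
      using f.RR_map_image[OF I] by (auto simp: RR_map_def[of N])
  next
    fix a assume "a \<in> RR_map N g (RR_map M f I)"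
    then obtain b where b: "b \<in> RR_map M f I" "a \<sqsubseteq>\<^bsub>N\<^esub> g b" "a \<in> carrier N" "b \<in> carrier M"
        "g b \<in> carrier N"
      using J g.RR_map_memE by blast
    from b(1) obtain c where c: "c \<in> I" "b \<sqsubseteq>\<^bsub>M\<^esub> f c" "f c \<in> carrier M"
      using I f.RR_map_memE by blast
    have "a \<sqsubseteq>\<^bsub>N\<^esub> g (f c)"
      using g.M.le_trans[of a "g b" "g (f c)"] b c g.hom_le[of b "f c"] g.hom_closed by auto
    then show "a \<in> RR_map N (g \<circ> f) I"
      using I b(3) c(1) by (intro gf.RR_map_memI) auto
  qed
qed

section \<open>The two proximities on round ideals\<close>

lemma round_ideal_order_RR: "proximity_frame L \<Longrightarrow> round_ideal_order L (RR L)"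
  by (simp add: round_ideal_order_def round_ideal_order_axioms_def RR_def)

lemma round_ideal_order_CC: "proximity_frame L \<Longrightarrow> round_ideal_order L (CC L)"
  by (simp add: round_ideal_order_def round_ideal_order_axioms_def CC_def)

lemma round_ideal_order_round_ideals:
  "proximity_frame L \<Longrightarrow> round_ideal_order L (round_ideals L)"
  by (simp add: round_ideal_order_def round_ideal_order_axioms_def round_ideals_def)

lemma carrier_RR: "carrier (RR L) = {I. round_ideal L I}"
  by (simp add: RR_def)

lemma carrier_CC: "carrier (CC L) = {I. round_ideal L I}"
  by (simp add: CC_def)

section \<open>The two relations in terms of joins, and why both are proximities\<close>

context proximity_frame
begin

lemma way_below_round_ideals:
  "\<lbrakk>round_ideal L I; round_ideal L J\<rbrakk> \<Longrightarrow> way_below (round_ideals L) I J \<longleftrightarrow> \<Squnion>I \<in> J"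
  using round_ideal_order.way_below_R[OF round_ideal_order_round_ideals[OF proximity_frame_axioms]]
  by (simp add: round_ideals_def)

lemma prox_RR:
  "\<lbrakk>round_ideal L I; round_ideal L J\<rbrakk> \<Longrightarrow> I \<prec>\<^bsub>RR L\<^esub> J \<longleftrightarrow> \<Squnion>I \<in> J"
  by (simp add: RR_def way_below_round_ideals)

lemma prox_CC:
  assumes "round_ideal L I" "round_ideal L J"
  shows "I \<prec>\<^bsub>CC L\<^esub> J \<longleftrightarrow> I \<subseteq> J \<and> \<Squnion>I \<prec> \<Squnion>J"
proof -
  have "\<Squnion>I \<in> carrier L" "\<Squnion>J \<in> carrier L" using assms round_ideal_carrier by auto
  then show ?thesis
    using assms by (simp add: CC_def RR_counit_def way_below_round_ideals kappa_round kappa_mem_iff)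
qed

lemma round_ideal_sup_closed: "round_ideal L I \<Longrightarrow> \<Squnion>I \<in> carrier L"
  using round_ideal_carrier by simp

lemma round_ideal_mem_le_sup: "\<lbrakk>round_ideal L I; a \<in> I\<rbrakk> \<Longrightarrow> a \<sqsubseteq> \<Squnion>I"
  by (rule sup_upper[OF round_ideal_carrier])

lemma round_ideal_sup_mono:
  "\<lbrakk>round_ideal L J; I \<subseteq> J\<rbrakk> \<Longrightarrow> \<Squnion>I \<sqsubseteq> \<Squnion>J"
  by (rule sup_mono[OF _ round_ideal_carrier])

lemma subset_if_sup_mem:
  assumes "round_ideal L I" "round_ideal L J" "\<Squnion>I \<in> J"
  shows "I \<subseteq> J"
proof
  fix a assume "a \<in> I"
  then show "a \<in> J"
    using round_ideal_down[OF assms(2,3)] round_ideal_mem_le_sup[OF assms(1)]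
      round_ideal_memD[OF assms(1)] by simp
qed

lemma prox_sup_if_mem:
  assumes J: "round_ideal L J" and a: "a \<in> J"
  shows "a \<prec> \<Squnion>J"
proof -
  obtain b where b: "b \<in> J" "a \<prec> b" using assms round_ideal_above by blast
  then show ?thesis
    using prox_le_trans[of a b "\<Squnion>J"] a round_ideal_mem_le_sup[OF J] round_ideal_memD[OF J]
      round_ideal_sup_closed[OF J] by simp
qed

text \<open>Every \<open>a \<in> J\<close> lies in \<open>kappa L b\<close> for some
  \<open>b \<in> J\<close> by roundness, so the ideals \<open>kappa L b\<close> alone already
  exhaust \<open>J\<close>. The family \<open>S\<close> is left open to cover the approximation
  axiom for both proximities and the first counit law.\<close>

lemma ideal_join_approximate:
  assumes J: "round_ideal L J"
    and S: "\<And>I. I \<in> S \<Longrightarrow> round_ideal L I \<and> I \<subseteq> J" "kappa L ` J \<subseteq> S"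
  shows "ideal_join L S = J"
proof
  show "ideal_join L S \<subseteq> J" using S(1) by (intro ideal_join_least[OF J]) blast
  show "J \<subseteq> ideal_join L S"
  proof
    fix a assume a: "a \<in> J"
    then obtain b where b: "b \<in> J" "a \<prec> b" using J round_ideal_above by blast
    then have "kappa L b \<in> S" using S(2) by blast
    moreover have "a \<in> kappa L b" using a b J round_ideal_memD by (simp add: kappa_mem_iff)
    ultimately show "a \<in> ideal_join L S"
      using ideal_join_upper[of "kappa L b" S] S(1) by blast
  qed
qed

lemma sup_ideal_join_pair:
  assumes "round_ideal L I" "round_ideal L J"
  shows "\<Squnion>(ideal_join L {I, J}) = \<Squnion>I \<squnion> \<Squnion>J"
  using assms sup_ideal_join[of "{I, J}"] by (auto simp: join_def)

lemma ideal_join_mono: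
  assumes "round_ideal L I1" "round_ideal L I2" "round_ideal L J1" "round_ideal L J2"
    "I1 \<subseteq> J1" "I2 \<subseteq> J2"
  shows "ideal_join L {I1, I2} \<subseteq> ideal_join L {J1, J2}"
proof (rule ideal_join_least)
  show "round_ideal L (ideal_join L {J1, J2})" using assms by (intro ideal_join_round) auto
  show "I \<subseteq> ideal_join L {J1, J2}" if "I \<in> {I1, I2}" for I
    using that assms ideal_join_upper[of J1 "{J1, J2}"] ideal_join_upper[of J2 "{J1, J2}"] by blast
qed

lemma proximity_frame_RR: "proximity_frame (RR L)"
proof -
  interpret R: round_ideal_order L "RR L"
    by (rule round_ideal_order_RR) (rule proximity_frame_axioms)
  interpret R: frame "RR L" by (rule R.frame_R)
  have prox: "I \<prec>\<^bsub>RR L\<^esub> J \<longleftrightarrow> \<Squnion>I \<in> J" if "I \<in> carrier (RR L)" "J \<in> carrier (RR L)" for I J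
    using that prox_RR by (simp add: carrier_RR)
  note round = R.carrier_R mem_Collect_eq
  show ?thesis
  proof
    show "I \<sqsubseteq>\<^bsub>RR L\<^esub> J" if "I \<in> carrier (RR L)" "J \<in> carrier (RR L)" "I \<prec>\<^bsub>RR L\<^esub> J" for I J
      using that prox[of I J] subset_if_sup_mem[of I J] by (simp add: R.le_R round)
    show "\<bottom>\<^bsub>RR L\<^esub> \<prec>\<^bsub>RR L\<^esub> \<bottom>\<^bsub>RR L\<^esub>"
      using prox[OF R.bottom_closed R.bottom_closed] by (simp add: R.bottom_R)
    show "\<top>\<^bsub>RR L\<^esub> \<prec>\<^bsub>RR L\<^esub> \<top>\<^bsub>RR L\<^esub>"
      using prox[OF R.top_closed R.top_closed] by (simp add: R.top_R)
    fix I1 J1 I2 J2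
    assume C: "I1 \<in> carrier (RR L)" "J1 \<in> carrier (RR L)" "I2 \<in> carrier (RR L)"
        "J2 \<in> carrier (RR L)"
      and p: "I1 \<prec>\<^bsub>RR L\<^esub> J1" "I2 \<prec>\<^bsub>RR L\<^esub> J2"
    have r: "round_ideal L I1" "round_ideal L J1" "round_ideal L I2" "round_ideal L J2"
      using C by (auto simp: round)
    have s: "\<Squnion>I1 \<in> J1" "\<Squnion>I2 \<in> J2" using p C prox by auto
    have sC: "\<Squnion>I1 \<in> carrier L" "\<Squnion>I2 \<in> carrier L" using r round_ideal_sup_closed by auto
    have "\<Squnion>I1 \<sqinter> \<Squnion>I2 \<in> J1 \<inter> J2"
      using s sC r
      by (auto intro: round_ideal_down[of J1 "\<Squnion>I1"] round_ideal_down[of J2 "\<Squnion>I2"]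
          meet_left meet_right)
    then show "I1 \<sqinter>\<^bsub>RR L\<^esub> I2 \<prec>\<^bsub>RR L\<^esub> J1 \<sqinter>\<^bsub>RR L\<^esub> J2"
      using prox[OF R.meet_closed[OF C(1,3)] R.meet_closed[OF C(2,4)]] C r
      by (simp add: R.meet_R sup_Int)
    have "\<Squnion>I1 \<squnion> \<Squnion>I2 \<in> ideal_join L {J1, J2}"
      unfolding join_def using s sC by (intro ideal_joinI[of _ "{\<Squnion>I1, \<Squnion>I2}"]) auto
    then show "I1 \<squnion>\<^bsub>RR L\<^esub> I2 \<prec>\<^bsub>RR L\<^esub> J1 \<squnion>\<^bsub>RR L\<^esub> J2"
      using prox[OF R.join_closed[OF C(1,3)] R.join_closed[OF C(2,4)]] C r
      by (simp add: R.join_R sup_ideal_join_pair)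
  next
    fix I J K K'
    assume C: "I \<in> carrier (RR L)" "J \<in> carrier (RR L)" "K \<in> carrier (RR L)"
        "K' \<in> carrier (RR L)"
      and p: "I \<sqsubseteq>\<^bsub>RR L\<^esub> J" "J \<prec>\<^bsub>RR L\<^esub> K" "K \<sqsubseteq>\<^bsub>RR L\<^esub> K'"
    have "\<Squnion>I \<sqsubseteq> \<Squnion>J" using p(1) C(2) round_ideal_sup_mono by (simp add: R.le_R round)
    moreover have "\<Squnion>J \<in> K'" using p(2,3) C prox by (auto simp: R.le_R)
    ultimately show "I \<prec>\<^bsub>RR L\<^esub> K'"
      using C prox round_ideal_down[of K' "\<Squnion>J" "\<Squnion>I"] round_ideal_sup_closed
      by (simp add: round)
  next
    fix I J assume C: "I \<in> carrier (RR L)" "J \<in> carrier (RR L)" and "I \<prec>\<^bsub>RR L\<^esub> J"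
    then have s: "\<Squnion>I \<in> J" and r: "round_ideal L I" "round_ideal L J"
      using prox by (auto simp: round)
    \<comment> \<open>The interpolant is \<open>kappa L b\<close>: it contains
      \<open>\<Squnion>I\<close>, and its own join \<open>b\<close> is still in
      \<open>J\<close>.\<close>
    then obtain b where b: "b \<in> J" "\<Squnion>I \<prec> b" using round_ideal_above by blast
    then have bC: "b \<in> carrier L" using r round_ideal_memD by blast
    have k: "kappa L b \<in> carrier (RR L)" using kappa_round[OF bC] by (simp add: round)
    show "\<exists>K\<in>carrier (RR L). I \<prec>\<^bsub>RR L\<^esub> K \<and> K \<prec>\<^bsub>RR L\<^esub> J"
      using k prox[OF C(1) k] prox[OF k C(2)] b bC r round_ideal_sup_closed
      by (auto simp: kappa_mem_iff sup_kappa)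
  next
    fix J assume C: "J \<in> carrier (RR L)"
    let ?S = "{I \<in> carrier (RR L). I \<prec>\<^bsub>RR L\<^esub> J}"
    have r: "round_ideal L J" using C by (simp add: round)
    have "ideal_join L ?S = J"
    proof (rule ideal_join_approximate[OF r])
      show "round_ideal L I \<and> I \<subseteq> J" if "I \<in> ?S" for I
        using that C prox subset_if_sup_mem[of I J] r by (auto simp: round)
      show "kappa L ` J \<subseteq> ?S"
        using C prox kappa_round round_ideal_memD[OF r] by (auto simp: round sup_kappa)
    qed
    then show "J = \<Squnion>\<^bsub>RR L\<^esub>?S" by (subst R.sup_R) auto
  qed
qed

lemma proximity_frame_CC: "proximity_frame (CC L)"
proof -
  interpret R: round_ideal_order L "CC L"
    by (rule round_ideal_order_CC) (rule proximity_frame_axioms)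
  interpret R: frame "CC L" by (rule R.frame_R)
  have prox: "I \<prec>\<^bsub>CC L\<^esub> J \<longleftrightarrow> I \<subseteq> J \<and> \<Squnion>I \<prec> \<Squnion>J"
    if "I \<in> carrier (CC L)" "J \<in> carrier (CC L)" for I J
    using that prox_CC by (simp add: carrier_CC)
  note round = R.carrier_R mem_Collect_eq
  show ?thesis
  proof
    show "I \<sqsubseteq>\<^bsub>CC L\<^esub> J" if "I \<in> carrier (CC L)" "J \<in> carrier (CC L)" "I \<prec>\<^bsub>CC L\<^esub> J" for I J
      using that prox[of I J] by (simp add: R.le_R)
    show "\<bottom>\<^bsub>CC L\<^esub> \<prec>\<^bsub>CC L\<^esub> \<bottom>\<^bsub>CC L\<^esub>"
      using prox[OF R.bottom_closed R.bottom_closed] by (simp add: R.bottom_R prox_bottom)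
    show "\<top>\<^bsub>CC L\<^esub> \<prec>\<^bsub>CC L\<^esub> \<top>\<^bsub>CC L\<^esub>"
      using prox[OF R.top_closed R.top_closed] by (simp add: R.top_R sup_carrier_eq prox_top)
    fix I1 J1 I2 J2
    assume C: "I1 \<in> carrier (CC L)" "J1 \<in> carrier (CC L)" "I2 \<in> carrier (CC L)"
        "J2 \<in> carrier (CC L)"
      and p: "I1 \<prec>\<^bsub>CC L\<^esub> J1" "I2 \<prec>\<^bsub>CC L\<^esub> J2"
    have r: "round_ideal L I1" "round_ideal L J1" "round_ideal L I2" "round_ideal L J2"
      using C by (auto simp: round)
    have s: "I1 \<subseteq> J1" "\<Squnion>I1 \<prec> \<Squnion>J1" "I2 \<subseteq> J2" "\<Squnion>I2 \<prec> \<Squnion>J2" using p C prox by auto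
    have "\<Squnion>I1 \<sqinter> \<Squnion>I2 \<prec> \<Squnion>J1 \<sqinter> \<Squnion>J2"
      using s r by (intro prox_meet round_ideal_sup_closed)
    then show "I1 \<sqinter>\<^bsub>CC L\<^esub> I2 \<prec>\<^bsub>CC L\<^esub> J1 \<sqinter>\<^bsub>CC L\<^esub> J2"
      using prox[OF R.meet_closed[OF C(1,3)] R.meet_closed[OF C(2,4)]] C r s
      by (auto simp: R.meet_R sup_Int)
    have "\<Squnion>I1 \<squnion> \<Squnion>I2 \<prec> \<Squnion>J1 \<squnion> \<Squnion>J2"
      using s r by (intro prox_join round_ideal_sup_closed)
    then show "I1 \<squnion>\<^bsub>CC L\<^esub> I2 \<prec>\<^bsub>CC L\<^esub> J1 \<squnion>\<^bsub>CC L\<^esub> J2"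
      using prox[OF R.join_closed[OF C(1,3)] R.join_closed[OF C(2,4)]] C r s
      by (simp add: R.join_R sup_ideal_join_pair ideal_join_mono)
  next
    fix I J K K'
    assume C: "I \<in> carrier (CC L)" "J \<in> carrier (CC L)" "K \<in> carrier (CC L)"
        "K' \<in> carrier (CC L)"
      and p: "I \<sqsubseteq>\<^bsub>CC L\<^esub> J" "J \<prec>\<^bsub>CC L\<^esub> K" "K \<sqsubseteq>\<^bsub>CC L\<^esub> K'"
    have r: "round_ideal L I" "round_ideal L J" "round_ideal L K" "round_ideal L K'"
      using C by (auto simp: round)
    have s: "I \<subseteq> J" "J \<subseteq> K" "\<Squnion>J \<prec> \<Squnion>K" "K \<subseteq> K'" using p C prox by (auto simp: R.le_R)
    have "\<Squnion>I \<prec> \<Squnion>K'"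
      using r s by (intro prox_mono[of "\<Squnion>I" "\<Squnion>J" "\<Squnion>K" "\<Squnion>K'"] round_ideal_sup_closed
          round_ideal_sup_mono)
    then show "I \<prec>\<^bsub>CC L\<^esub> K'" using C prox s by auto
  next
    fix I J assume C: "I \<in> carrier (CC L)" "J \<in> carrier (CC L)" and p: "I \<prec>\<^bsub>CC L\<^esub> J"
    then have s: "I \<subseteq> J" "\<Squnion>I \<prec> \<Squnion>J" and r: "round_ideal L I" "round_ideal L J"
      using prox by (auto simp: round)
    obtain c where c: "c \<in> carrier L" "\<Squnion>I \<prec> c" "c \<prec> \<Squnion>J"
      using prox_interpolate[OF round_ideal_sup_closed[OF r(1)] round_ideal_sup_closed[OF r(2)] s(2)]
      by blast
    have kr: "round_ideal L (kappa L c)" by (rule kappa_round[OF c(1)])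
    \<comment> \<open>\<open>kappa L c\<close> has the right join \<open>c\<close> but need not be
      contained in \<open>J\<close>, since \<open>c \<prec> \<Squnion>J\<close> does not place
      \<open>c\<close> in \<open>J\<close>. Intersecting with \<open>J\<close> forces the inclusion,
      and \<open>c \<sqsubseteq> \<Squnion>J\<close> keeps the join equal to
      \<open>c\<close>.\<close>
    let ?K = "J \<inter> kappa L c"
    have K: "?K \<in> carrier (CC L)" using round_ideal_Int[OF r(2) kr] by (simp add: round)
    have "\<Squnion>?K = \<Squnion>J \<sqinter> c" by (simp add: sup_Int[OF r(2) kr] sup_kappa c(1))
    also have "\<dots> = c"
      using le_iff_join[of c "\<Squnion>J"] prox_le[OF c(1) round_ideal_sup_closed[OF r(2)] c(3)] c(1)
        round_ideal_sup_closed[OF r(2)] by (simp add: meet_comm)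
    finally have supK: "\<Squnion>?K = c" .
    have "I \<subseteq> kappa L c"
      using subset_if_sup_mem[OF r(1) kr] c(2) round_ideal_sup_closed[OF r(1)]
      by (simp add: kappa_mem_iff)
    then show "\<exists>K\<in>carrier (CC L). I \<prec>\<^bsub>CC L\<^esub> K \<and> K \<prec>\<^bsub>CC L\<^esub> J"
      using K prox[OF C(1) K] prox[OF K C(2)] s c by (auto simp: supK)
  next
    fix J assume C: "J \<in> carrier (CC L)"
    let ?S = "{I \<in> carrier (CC L). I \<prec>\<^bsub>CC L\<^esub> J}"
    have r: "round_ideal L J" using C by (simp add: round)
    have "ideal_join L ?S = J"
    proof (rule ideal_join_approximate[OF r])
      show "round_ideal L I \<and> I \<subseteq> J" if "I \<in> ?S" for I
        using that C prox by (auto simp: round)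
      show "kappa L ` J \<subseteq> ?S"
      proof
        fix K assume "K \<in> kappa L ` J"
        then obtain b where b: "b \<in> J" "K = kappa L b" by blast
        then have bC: "b \<in> carrier L" using r round_ideal_memD by blast
        have "K \<in> carrier (CC L)" using kappa_round[OF bC] b(2) by (simp add: round)
        then show "K \<in> ?S"
          using prox[of K J] C kappa_subset[OF r b(1)] prox_sup_if_mem[OF r b(1)] b(2) bC
          by (simp add: sup_kappa)
      qed
    qed
    then show "J = \<Squnion>\<^bsub>CC L\<^esub>?S" by (subst R.sup_R) auto
  qed
qed

end

text \<open>The proximities between those of \<open>RR L\<close> and \<open>CC L\<close>: on all of them the comultiplication
  is given by the same formula.\<close>

locale round_ideal_proximity = round_ideal_order L R
  for L :: "'a pframe" (structure) and R :: "'a set pframe" +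
  assumes proximity_R: "proximity_frame R"
    and prox_R_if_sup_mem:
      "\<lbrakk>I \<in> carrier R; J \<in> carrier R; \<Squnion>I \<in> J\<rbrakk> \<Longrightarrow> I \<prec>\<^bsub>R\<^esub> J"
    and sup_prox_if_prox_R:
      "\<lbrakk>I \<in> carrier R; J \<in> carrier R; I \<prec>\<^bsub>R\<^esub> J\<rbrakk> \<Longrightarrow> \<Squnion>I \<prec> \<Squnion>J"
begin

interpretation R: proximity_frame R by (rule proximity_R)

lemma kappa_closed: "a \<in> carrier L \<Longrightarrow> kappa L a \<in> carrier R"
  by (simp add: carrier_R kappa_round)

lemma round_R: "I \<in> carrier R \<longleftrightarrow> round_ideal L I"
  by (simp add: carrier_R)

text \<open>The two bounds on the proximity of \<open>R\<close> pinch at targets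
  \<open>kappa L b\<close>: the sufficient condition \<open>\<Squnion>K \<in> kappa L b\<close> and
  the necessary one \<open>\<Squnion>K \<prec> \<Squnion>(kappa L b)\<close> both say
  \<open>\<Squnion>K \<prec> b\<close>. Roundness of \<open>I\<close> then absorbs
  \<open>b\<close>.\<close>

lemma comult_eq:
  assumes I: "round_ideal L I"
  shows "RR_map R (kappa L) I = {K. round_ideal L K \<and> \<Squnion>K \<in> I}"
proof (intro subset_antisym subsetI)
  fix K assume "K \<in> RR_map R (kappa L) I"
  then obtain b where K: "K \<in> carrier R" and b: "b \<in> I" "K \<prec>\<^bsub>R\<^esub> kappa L b"
    by (auto simp: RR_map_def)
  have bC: "b \<in> carrier L" using b I round_ideal_memD by blast
  have "\<Squnion>K \<prec> b" using sup_prox_if_prox_R[OF K kappa_closed[OF bC] b(2)] bC by (simp add: sup_kappa)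
  then show "K \<in> {K. round_ideal L K \<and> \<Squnion>K \<in> I}"
    using K b I bC round_ideal_mem_iff[OF I, of "\<Squnion>K"] round_ideal_sup_closed by (auto simp: round_R)
next
  fix K assume "K \<in> {K. round_ideal L K \<and> \<Squnion>K \<in> I}"
  then have K: "round_ideal L K" "\<Squnion>K \<in> I" by auto
  obtain b where b: "b \<in> I" "\<Squnion>K \<prec> b" using K I round_ideal_above by blast
  have bC: "b \<in> carrier L" using b I round_ideal_memD by blast
  have "K \<prec>\<^bsub>R\<^esub> kappa L b"
    using K b bC round_ideal_sup_closed
    by (intro prox_R_if_sup_mem kappa_closed) (auto simp: round_R kappa_mem_iff)
  then show "K \<in> RR_map R (kappa L) I" using K b by (auto simp: RR_map_def round_R)
qed

lemma comult_round:
  assumes I: "round_ideal L I"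
  shows "round_ideal R (RR_map R (kappa L) I)"
  unfolding comult_eq[OF I]
proof (rule R.round_idealI)
  show "{K. round_ideal L K \<and> \<Squnion>K \<in> I} \<subseteq> carrier R" by (auto simp: round_R)
  show "K \<in> {K. round_ideal L K \<and> \<Squnion>K \<in> I}"
    if "K' \<in> {K. round_ideal L K \<and> \<Squnion>K \<in> I}" "K \<in> carrier R" "K \<sqsubseteq>\<^bsub>R\<^esub> K'" for K K'
    using that I round_ideal_down[of I "\<Squnion>K'" "\<Squnion>K"] round_ideal_sup_mono[of K' K]
      round_ideal_sup_closed by (auto simp: round_R le_R)
  show "\<Squnion>\<^bsub>R\<^esub>F \<in> {K. round_ideal L K \<and> \<Squnion>K \<in> I}"
    if F: "finite F" "F \<subseteq> {K. round_ideal L K \<and> \<Squnion>K \<in> I}" for F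
  proof -
    have r: "\<And>K. K \<in> F \<Longrightarrow> round_ideal L K" using F(2) by blast
    then have FR: "F \<subseteq> carrier R" by (auto simp: round_R)
    have "(\<lambda>K. \<Squnion>K) ` F \<subseteq> I" using F(2) by blast
    then show ?thesis
      using F(1) I round_ideal_sup[of I "(\<lambda>K. \<Squnion>K) ` F"] ideal_join_round[OF r]
      by (simp add: sup_R[OF FR] sup_ideal_join[OF r])
  qed
  show "\<exists>K'\<in>{K. round_ideal L K \<and> \<Squnion>K \<in> I}. K \<prec>\<^bsub>R\<^esub> K'"
    if K: "K \<in> {K. round_ideal L K \<and> \<Squnion>K \<in> I}" for K
  proof -
    \<comment> \<open>\<open>kappa L b\<close> is the larger member sought: its join
      \<open>b\<close> lies in \<open>I\<close>, and it contains \<open>\<Squnion>K\<close>, which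
      suffices for every admissible proximity.\<close>
    obtain b where b: "b \<in> I" "\<Squnion>K \<prec> b" using K I round_ideal_above by blast
    have bC: "b \<in> carrier L" using b I round_ideal_memD by blast
    have "K \<prec>\<^bsub>R\<^esub> kappa L b"
      using K b bC round_ideal_sup_closed
      by (intro prox_R_if_sup_mem kappa_closed) (auto simp: round_R kappa_mem_iff)
    then show ?thesis
      using b bC kappa_round by (intro bexI[of _ "kappa L b"]) (auto simp: sup_kappa)
  qed
qed

text \<open>First counit law: the ideals \<open>K\<close> with \<open>\<Squnion>K \<in> I\<close>
  are contained in \<open>I\<close>, and among them are all \<open>kappa L b\<close> with
  \<open>b \<in> I\<close>, which generate it.\<close>

lemma sup_comult:
  assumes I: "round_ideal L I"
  shows "\<Squnion>\<^bsub>R\<^esub>(RR_map R (kappa L) I) = I"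
proof -
  have "ideal_join L {K. round_ideal L K \<and> \<Squnion>K \<in> I} = I"
    using subset_if_sup_mem[OF _ I] kappa_round round_ideal_memD[OF I]
    by (intro ideal_join_approximate[OF I]) (auto simp: sup_kappa)
  then show ?thesis by (simp add: comult_eq[OF I] sup_R Collect_mono carrier_R)
qed

text \<open>Second counit law: the joins of the ideals in the comultiplication of \<open>I\<close>
  are exactly the elements of \<open>I\<close>, as \<open>kappa L b\<close> realises
  \<open>b\<close>; what remains is membership in a round ideal expressed by
  \<open>\<prec>\<close>.\<close>

lemma RR_map_sup_comult:
  assumes I: "round_ideal L I"
  shows "RR_map L (\<lambda>K. \<Squnion>K) (RR_map R (kappa L) I) = I"
proof (intro subset_antisym subsetI)
  fix a assume "a \<in> RR_map L (\<lambda>K. \<Squnion>K) (RR_map R (kappa L) I)"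
  then show "a \<in> I"
    using round_ideal_mem_iff[OF I, of a] by (auto simp: comult_eq[OF I] RR_map_def[of L])
next
  fix a assume a: "a \<in> I"
  then obtain b where b: "b \<in> I" "a \<prec> b" using I round_ideal_above by blast
  then have "b \<in> carrier L" "a \<in> carrier L" using a I round_ideal_memD by blast+
  moreover from this have "kappa L b \<in> RR_map R (kappa L) I" "a \<prec> \<Squnion>(kappa L b)"
    using b by (simp_all add: comult_eq[OF I] sup_kappa kappa_round)
  ultimately show "a \<in> RR_map L (\<lambda>K. \<Squnion>K) (RR_map R (kappa L) I)"
    unfolding RR_map_def[of L] by blast
qed

text \<open>Meets are immediate from the condition \<open>\<Squnion>K \<in> I\<close>. Joins are the
  real content: from a finite set of elements bounding \<open>\<Squnion>K\<close> one needs a finite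
  set of round ideals whose join contains \<open>K\<close> and each of which has its join in some
  member of \<open>S\<close>.\<close>

lemma comult_frame_hom:
  assumes "round_ideal_order R R'"
  shows "RR_map R (kappa L) \<in> frame_hom R R'"
proof -
  interpret R': round_ideal_order R R' by fact
  let ?c = "RR_map R (kappa L)"
  show ?thesis
  proof (rule frame_homI[OF complete_lattice_R R'.complete_lattice_R])
    show closed: "?c I \<in> carrier R'" if "I \<in> carrier R" for I
      using that comult_round by (simp add: round_R R'.carrier_R)
    show "?c \<top>\<^bsub>R\<^esub> = \<top>\<^bsub>R'\<^esub>"
      using round_ideal_sup_closed
      by (auto simp: top_R R'.top_R comult_eq[OF round_ideal_carrier_set] carrier_R)
    show "?c (I \<sqinter>\<^bsub>R\<^esub> J) = ?c I \<sqinter>\<^bsub>R'\<^esub> ?c J" if "I \<in> carrier R" "J \<in> carrier R" for I J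
      using that closed round_ideal_Int by (auto simp: meet_R R'.meet_R round_R comult_eq)
    show "?c (\<Squnion>\<^bsub>R\<^esub>S) = \<Squnion>\<^bsub>R'\<^esub>(?c ` S)" if S: "S \<subseteq> carrier R" for S
    proof -
      have r: "\<And>I. I \<in> S \<Longrightarrow> round_ideal L I" using S by (auto simp: round_R)
      have cS: "?c ` S \<subseteq> carrier R'" using S closed by blast
      have j: "round_ideal L (ideal_join L S)" by (rule ideal_join_round[OF r])
      have "?c (ideal_join L S) \<subseteq> ideal_join R (?c ` S)"
      proof
        fix K assume "K \<in> ?c (ideal_join L S)"
        then have K: "round_ideal L K" "\<Squnion>K \<in> ideal_join L S" by (auto simp: comult_eq[OF j])
        then obtain F where F: "finite F" "F \<subseteq> \<Union>S" "\<Squnion>K \<sqsubseteq> \<Squnion>F" by (auto simp: ideal_join_def)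
        have FC: "F \<subseteq> carrier L" using F(2) r round_ideal_memD by blast
        \<comment> \<open>\<open>kappa L x\<close> need not contain \<open>x\<close>. Raising
          \<open>x\<close> to \<open>g x\<close> inside the same member \<open>h x\<close> of
          \<open>S\<close> repairs this: \<open>kappa L (g x)\<close> contains \<open>x\<close>, and
          its join \<open>g x\<close> is still in \<open>h x\<close>.\<close>
        have "\<forall>x\<in>F. \<exists>y I. I \<in> S \<and> y \<in> I \<and> x \<prec> y"
          using F(2) r by (meson UnionE round_ideal_above subsetD)
        then obtain g h where g: "\<And>x. x \<in> F \<Longrightarrow> h x \<in> S \<and> g x \<in> h x \<and> x \<prec> g x" by metis
        have gC: "g x \<in> carrier L" if "x \<in> F" for x
          using g[OF that] r round_ideal_memD by blast
        let ?G = "(\<lambda>x. kappa L (g x)) ` F"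
        have GR: "?G \<subseteq> carrier R" using gC kappa_closed by blast
        have "K \<subseteq> ideal_join L ?G"
        proof
          fix x assume x: "x \<in> K"
          then have xC: "x \<in> carrier L" using K(1) round_ideal_memD by blast
          have "x \<sqsubseteq> \<Squnion>F"
            using le_trans[OF round_ideal_mem_le_sup[OF K(1) x] F(3)] xC FC
              round_ideal_sup_closed[OF K(1)] by simp
          moreover have "F \<subseteq> \<Union>?G"
          proof
            fix y assume y: "y \<in> F"
            then have "y \<in> kappa L (g y)" using g FC by (auto simp: kappa_mem_iff)
            then show "y \<in> \<Union>?G" using y by blast
          qed
          ultimately show "x \<in> ideal_join L ?G" using xC F(1) ideal_joinI by blast
        qed
        then have "K \<sqsubseteq>\<^bsub>R\<^esub> \<Squnion>\<^bsub>R\<^esub>?G" by (simp add: le_R sup_R[OF GR])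
        moreover have "?G \<subseteq> \<Union>(?c ` S)"
        proof
          fix X assume "X \<in> ?G"
          then obtain x where x: "x \<in> F" "X = kappa L (g x)" by blast
          then have "X \<in> ?c (h x)"
            using g[OF x(1)] gC[OF x(1)] r by (simp add: comult_eq kappa_round sup_kappa)
          then show "X \<in> \<Union>(?c ` S)" using g[OF x(1)] by blast
        qed
        ultimately show "K \<in> ideal_join R (?c ` S)"
          using K(1) F(1) by (intro R.ideal_joinI[of _ ?G]) (auto simp: round_R)
      qed
      moreover have "ideal_join R (?c ` S) \<subseteq> ?c (ideal_join L S)"
      proof (rule R.ideal_join_least[OF comult_round[OF j]])
        fix X assume "X \<in> ?c ` S"
        then obtain I where "I \<in> S" "X = ?c I" by blast
        then show "X \<subseteq> ?c (ideal_join L S)"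
          using ideal_join_upper[of I S] r by (auto simp: comult_eq j)
      qed
      ultimately show ?thesis using S cS by (simp add: sup_R R'.sup_R)
    qed
  qed
qed

lemma counit_frame_hom: "(\<lambda>K. \<Squnion>K) \<in> frame_hom R L"
proof (rule frame_homI[OF complete_lattice_R complete_lattice_axioms])
  show "\<Squnion>I \<in> carrier L" if "I \<in> carrier R" for I
    using that round_ideal_sup_closed by (simp add: round_R)
  show "\<Squnion>\<top>\<^bsub>R\<^esub> = \<top>" by (simp add: top_R sup_carrier_eq)
  show "\<Squnion>(I \<sqinter>\<^bsub>R\<^esub> J) = \<Squnion>I \<sqinter> \<Squnion>J" if "I \<in> carrier R" "J \<in> carrier R" for I J
    using that by (simp add: meet_R sup_Int round_R)
  show "\<Squnion>\<Squnion>\<^bsub>R\<^esub>S = \<Squnion>((\<lambda>K. \<Squnion>K) ` S)" if "S \<subseteq> carrier R" for S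
    using that by (subst sup_R) (auto intro!: sup_ideal_join simp: round_R)
qed

lemma counit_prox_hom: "(\<lambda>K. \<Squnion>K) \<in> prox_hom R L"
  using counit_frame_hom sup_prox_if_prox_R by (rule prox_homI)

text \<open>For \<open>\<Squnion>\<Squnion>\<K> \<in> I\<close> the witness \<open>\<Squnion>\<K>\<close> would do for the way-below relation only;
  \<open>kappa L b\<close> with \<open>\<Squnion>\<Squnion>\<K> \<prec> b \<in> I\<close> does for every proximity.\<close>
lemma comult_coassoc:
  assumes "round_ideal_proximity R R'"
    and hom: "RR_map R (kappa L) \<in> prox_hom R R'"
    and I: "round_ideal L I"
  shows "RR_map R' (kappa R) (RR_map R (kappa L) I) =
    RR_map R' (RR_map R (kappa L)) (RR_map R (kappa L) I)" 
proof -
  let ?c = "RR_map R (kappa L)"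

  interpret R': round_ideal_proximity R R' by fact
  interpret c: proximity_hom R R' ?c
    by (intro proximity_hom.intro proximity_hom_axioms.intro proximity_R R'.proximity_R hom)
  have cI: "round_ideal R (?c I)" by (rule comult_round[OF I])
  \<comment> \<open>The left side is membership of \<K> in the outer comultiplication by
    \<open>comult_eq\<close> one level up; the right side is membership in the image under
    \<open>?c\<close>, written with the order.\<close>
  have key: "\<Squnion>\<^bsub>R\<^esub>\<K> \<in> ?c I \<longleftrightarrow> (\<exists>K\<in>?c I. \<K> \<subseteq> ?c K)" if K: "round_ideal R \<K>" for \<K>
  proof
    have KR: "\<K> \<subseteq> carrier R" using K R.round_ideal_carrier by blast
    assume "\<Squnion>\<^bsub>R\<^esub>\<K> \<in> ?c I"
    then have s: "round_ideal L (\<Squnion>\<^bsub>R\<^esub>\<K>)" "\<Squnion>\<Squnion>\<^bsub>R\<^esub>\<K> \<in> I" by (auto simp: comult_eq[OF I])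
    then obtain b where b: "b \<in> I" "\<Squnion>\<Squnion>\<^bsub>R\<^esub>\<K> \<prec> b" using I round_ideal_above by blast
    then have bC: "b \<in> carrier L" using I round_ideal_memD by blast
    have "\<K> \<subseteq> ?c (kappa L b)"
    proof
      fix K assume Kin: "K \<in> \<K>"
      then have "K \<sqsubseteq>\<^bsub>R\<^esub> \<Squnion>\<^bsub>R\<^esub>\<K>" using KR R.sup_upper by blast
      then have "\<Squnion>K \<sqsubseteq> \<Squnion>\<Squnion>\<^bsub>R\<^esub>\<K>" using s(1) round_ideal_sup_mono by (simp add: le_R)
      moreover have rK: "round_ideal L K" using Kin KR by (auto simp: round_R)
      ultimately show "K \<in> ?c (kappa L b)"
        using b(2) bC le_prox_trans[of "\<Squnion>K" "\<Squnion>\<Squnion>\<^bsub>R\<^esub>\<K>" b] s(1) round_ideal_sup_closed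
        by (simp add: comult_eq[OF kappa_round[OF bC]] kappa_mem_iff)
    qed
    moreover have "kappa L b \<in> ?c I"
      using b bC by (simp add: comult_eq[OF I] kappa_round sup_kappa)
    ultimately show "\<exists>K\<in>?c I. \<K> \<subseteq> ?c K" by blast
  next
    have KR: "\<K> \<subseteq> carrier R" using K R.round_ideal_carrier by blast
    assume "\<exists>K\<in>?c I. \<K> \<subseteq> ?c K"
    then obtain J where J: "J \<in> ?c I" "\<K> \<subseteq> ?c J" by blast
    then have r: "round_ideal L J" by (auto simp: comult_eq[OF I])
    \<comment> \<open>Taking joins lets the first counit law replace \<open>?c J\<close> by
      \<open>J\<close>, which is a member of the downset \<open>?c I\<close>.\<close>
    have "\<Squnion>\<^bsub>R\<^esub>\<K> \<sqsubseteq>\<^bsub>R\<^esub> \<Squnion>\<^bsub>R\<^esub>(?c J)"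
      by (rule R.round_ideal_sup_mono[OF comult_round[OF r] J(2)])
    then have "\<Squnion>\<^bsub>R\<^esub>\<K> \<sqsubseteq>\<^bsub>R\<^esub> J" by (simp add: sup_comult[OF r])
    then show "\<Squnion>\<^bsub>R\<^esub>\<K> \<in> ?c I"
      using R.round_ideal_down[OF cI J(1)] KR by simp
  qed
  show ?thesis
    unfolding R'.comult_eq[OF cI] c.RR_map_eq[OF cI]
    using key by (auto simp: R'.carrier_R R'.le_R)
qed

end

text \<open>Membership of \<open>K\<close> unfolds on one side to a condition on its join and on the
  other to containment in the image of some \<open>J\<close> with join in \<open>I\<close>. From the
  second to the first, \<open>f\<close> applied to the join of \<open>J\<close> is the required
  bound.\<close>

lemma comult_natural:
  assumes "round_ideal_proximity L R" "round_ideal_proximity M R'" "proximity_hom L M f"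
    and hom: "RR_map M f \<in> prox_hom R R'"
    and I: "round_ideal L I"
  shows "RR_map R' (kappa M) (RR_map M f I) = RR_map R' (RR_map M f) (RR_map R (kappa L) I)"
proof -
  interpret R: round_ideal_proximity L R by fact
  interpret R': round_ideal_proximity M R' by fact
  interpret f: proximity_hom L M f by fact
  interpret Rf: proximity_hom R R' "RR_map M f"
    by (intro proximity_hom.intro proximity_hom_axioms.intro R.proximity_R R'.proximity_R hom)
  have "\<Squnion>\<^bsub>M\<^esub>K \<in> RR_map M f I \<longleftrightarrow> (\<exists>J\<in>RR_map R (kappa L) I. K \<subseteq> RR_map M f J)"
    if K: "round_ideal M K" for K
  proof
    assume "\<Squnion>\<^bsub>M\<^esub>K \<in> RR_map M f I"
    then obtain b where b: "b \<in> I" "\<Squnion>\<^bsub>M\<^esub>K \<sqsubseteq>\<^bsub>M\<^esub> f b" "\<Squnion>\<^bsub>M\<^esub>K \<in> carrier M" "b \<in> carrier L"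
      using I f.RR_map_memE by blast
    \<comment> \<open>The witness \<open>J\<close> is \<open>kappa L c\<close>: it contains
      \<open>b\<close>, so its image contains the join of \<open>K\<close>, and its own join
      \<open>c\<close> has not left \<open>I\<close>.\<close>
    obtain c where c: "c \<in> I" "b \<prec>\<^bsub>L\<^esub> c" using b I R.round_ideal_above by blast
    then have cC: "c \<in> carrier L" using I R.round_ideal_memD by blast
    have k: "round_ideal L (kappa L c)" by (rule R.kappa_round[OF cC])
    have "\<Squnion>\<^bsub>M\<^esub>K \<in> RR_map M f (kappa L c)"
      using b c k by (intro f.RR_map_memI[of _ b]) (auto simp: R.kappa_mem_iff)
    then have "K \<subseteq> RR_map M f (kappa L c)"
      using K k by (intro R'.subset_if_sup_mem f.RR_map_round)
    moreover have "kappa L c \<in> RR_map R (kappa L) I"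
      using c cC k by (simp add: R.comult_eq[OF I] R.sup_kappa)
    ultimately show "\<exists>J\<in>RR_map R (kappa L) I. K \<subseteq> RR_map M f J" by blast
  next
    assume "\<exists>J\<in>RR_map R (kappa L) I. K \<subseteq> RR_map M f J"
    then obtain J where J: "round_ideal L J" "\<Squnion>\<^bsub>L\<^esub>J \<in> I" "K \<subseteq> RR_map M f J"
      by (auto simp: R.comult_eq[OF I])
    have "\<Squnion>\<^bsub>M\<^esub>K \<sqsubseteq>\<^bsub>M\<^esub> f (\<Squnion>\<^bsub>L\<^esub>J)"
      using R'.round_ideal_sup_mono[OF f.RR_map_round[OF J(1)] J(3)] f.sup_RR_map[OF J(1)] by simp
    then show "\<Squnion>\<^bsub>M\<^esub>K \<in> RR_map M f I"
      using I J(2) K R'.round_ideal_sup_closed by (intro f.RR_map_memI)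
  qed
  then show ?thesis
    unfolding R'.comult_eq[OF f.RR_map_round[OF I]] Rf.RR_map_eq[OF R.comult_round[OF I]]
    by (auto simp: R'.round_R R'.le_R)
qed

section \<open>The two comonads\<close>

lemma round_ideal_proximity_RR:
  assumes "proximity_frame L"
  shows "round_ideal_proximity L (RR L)"
proof -
  interpret proximity_frame L by fact
  show ?thesis
    using prox_sup_if_mem
    by (intro round_ideal_proximity.intro round_ideal_proximity_axioms.intro
        round_ideal_order_RR proximity_frame_axioms proximity_frame_RR)
      (auto simp: carrier_RR prox_RR)
qed

lemma round_ideal_proximity_CC:
  assumes "proximity_frame L"
  shows "round_ideal_proximity L (CC L)"
proof -
  interpret proximity_frame L by fact
  show ?thesis
  proof (intro round_ideal_proximity.intro round_ideal_proximity_axioms.intro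
      round_ideal_order_CC proximity_frame_axioms proximity_frame_CC)
    show "I \<prec>\<^bsub>CC L\<^esub> J" if "I \<in> carrier (CC L)" "J \<in> carrier (CC L)" "\<Squnion>\<^bsub>L\<^esub>I \<in> J" for I J
      using that subset_if_sup_mem[of I J] prox_sup_if_mem[of J "\<Squnion>\<^bsub>L\<^esub>I"]
      by (simp add: carrier_CC prox_CC)
  qed (simp add: carrier_CC prox_CC)
qed

section \<open>Structure maps as morphisms of proximity frames\<close>

lemma RR_counit_eq: "RR_counit L = (\<lambda>I. \<Squnion>\<^bsub>L\<^esub>I)"
  by (rule ext) (simp add: RR_counit_def)

lemma CC_counit_eq: "CC_counit L = (\<lambda>I. \<Squnion>\<^bsub>L\<^esub>I)"
  by (rule ext) (simp add: CC_counit_def)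

lemma CC_comult_eq: "CC_comult L = RR_map (CC L) (kappa L)"
  by (rule ext) (simp add: CC_comult_def RR_map_def)

lemma CC_map_eq: "CC_map M f = RR_map M f"
  by (rule ext) (simp add: CC_map_def)

text \<open>If the join of \<open>I\<close> lies in \<open>J\<close>, then its value under
  \<open>f\<close> lies in the image of \<open>J\<close>; by \<open>sup_RR_map\<close> that value is
  the join of the image of \<open>I\<close>.\<close>

lemma RR_map_prox_hom_RR:
  assumes "proximity_hom L M f"
  shows "RR_map M f \<in> prox_hom (RR L) (RR M)"
proof -
  interpret proximity_hom L M f by fact
  show ?thesis
  proof (rule prox_homI)
    show "RR_map M f \<in> frame_hom (RR L) (RR M)"
      by (intro RR_map_frame_hom round_ideal_order_RR proximity_frame_axioms
          M.proximity_frame_axioms)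
    show "RR_map M f I \<prec>\<^bsub>RR M\<^esub> RR_map M f J"
      if "I \<in> carrier (RR L)" "J \<in> carrier (RR L)" "I \<prec>\<^bsub>RR L\<^esub> J" for I J
      using that RR_map_image[of J "\<Squnion>\<^bsub>L\<^esub>I"]
      by (simp add: carrier_RR prox_RR M.prox_RR RR_map_round sup_RR_map)
  qed
qed

lemma RR_map_prox_hom_CC:
  assumes "proximity_hom L M f"
  shows "RR_map M f \<in> prox_hom (CC L) (CC M)"
proof -
  interpret proximity_hom L M f by fact
  show ?thesis
  proof (rule prox_homI)
    show "RR_map M f \<in> frame_hom (CC L) (CC M)"
      by (intro RR_map_frame_hom round_ideal_order_CC proximity_frame_axioms
          M.proximity_frame_axioms)
    show "RR_map M f I \<prec>\<^bsub>CC M\<^esub> RR_map M f J"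
      if "I \<in> carrier (CC L)" "J \<in> carrier (CC L)" "I \<prec>\<^bsub>CC L\<^esub> J" for I J
    proof -
      have r: "round_ideal L I" "round_ideal L J" and s: "I \<subseteq> J" "\<Squnion>\<^bsub>L\<^esub>I \<prec>\<^bsub>L\<^esub> \<Squnion>\<^bsub>L\<^esub>J"
        using that by (simp_all add: carrier_CC prox_CC)
      have "RR_map M f I \<subseteq> RR_map M f J" using s(1) unfolding RR_map_def by blast
      moreover have "f (\<Squnion>\<^bsub>L\<^esub>I) \<prec>\<^bsub>M\<^esub> f (\<Squnion>\<^bsub>L\<^esub>J)"
        using r s(2) by (intro hom_prox round_ideal_sup_closed)
      ultimately show ?thesis using r by (simp add: M.prox_CC RR_map_round sup_RR_map)
    qed
  qed
qed

lemma RR_comult_prox_hom: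
  assumes "proximity_frame L"
  shows "RR_map (RR L) (kappa L) \<in> prox_hom (RR L) (RR (RR L))"
proof -
  interpret R: round_ideal_proximity L "RR L" by (rule round_ideal_proximity_RR[OF assms])
  interpret RR: proximity_frame "RR L" by (rule R.proximity_R)
  show ?thesis
  proof (rule prox_homI)
    show "RR_map (RR L) (kappa L) \<in> frame_hom (RR L) (RR (RR L))"
      by (intro R.comult_frame_hom round_ideal_order_RR R.proximity_R)
    show "RR_map (RR L) (kappa L) I \<prec>\<^bsub>RR (RR L)\<^esub> RR_map (RR L) (kappa L) J"
      if "I \<in> carrier (RR L)" "J \<in> carrier (RR L)" "I \<prec>\<^bsub>RR L\<^esub> J" for I J
      using that
      \<comment> \<open>The first simplification reduces the goal by \<open>sup_comult\<close> to
        membership of \<open>I\<close> in the comultiplication of \<open>J\<close>.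
        \<open>comult_eq\<close> is held back because it would rewrite the terms that
        \<open>sup_comult\<close> has to match.\<close>
      by (simp add: carrier_RR R.prox_RR RR.prox_RR R.comult_round R.sup_comult)
        (simp add: R.comult_eq)
  qed
qed

lemma CC_comult_prox_hom:
  assumes "proximity_frame L"
  shows "RR_map (CC L) (kappa L) \<in> prox_hom (CC L) (CC (CC L))"
proof -
  interpret R: round_ideal_proximity L "CC L" by (rule round_ideal_proximity_CC[OF assms])
  interpret CC: proximity_frame "CC L" by (rule R.proximity_R)
  show ?thesis
  proof (rule prox_homI)
    show "RR_map (CC L) (kappa L) \<in> frame_hom (CC L) (CC (CC L))"
      by (intro R.comult_frame_hom round_ideal_order_CC R.proximity_R)
    show "RR_map (CC L) (kappa L) I \<prec>\<^bsub>CC (CC L)\<^esub> RR_map (CC L) (kappa L) J"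
      if "I \<in> carrier (CC L)" "J \<in> carrier (CC L)" "I \<prec>\<^bsub>CC L\<^esub> J" for I J
    proof -
      have r: "round_ideal L I" "round_ideal L J" and s: "I \<subseteq> J"
        using that by (simp_all add: carrier_CC R.prox_CC)
      have "RR_map (CC L) (kappa L) I \<subseteq> RR_map (CC L) (kappa L) J"
        using s unfolding RR_map_def by blast
      \<comment> \<open>By \<open>sup_comult\<close> the joins of the two images are
        \<open>I\<close> and \<open>J\<close>, so beyond the inclusion the goal is the hypothesis
        itself.\<close>
      then show ?thesis
        using r that(3) by (simp add: CC.prox_CC R.comult_round R.sup_comult)
    qed
  qed
qed

section \<open>The comparison \<open>beta\<close> and its horizontal square\<close>

lemma beta_eq: "round_ideal L I \<Longrightarrow> beta L I = I"
  by (simp add: beta_def carrier_RR)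

lemma beta_prox_hom:
  assumes "proximity_frame L"
  shows "beta L \<in> prox_hom (RR L) (CC L)"
proof -
  interpret R: round_ideal_proximity L "RR L" by (rule round_ideal_proximity_RR[OF assms])
  interpret C: round_ideal_proximity L "CC L" by (rule round_ideal_proximity_CC[OF assms])
  show ?thesis
  proof (rule prox_homI)
    show "beta L \<in> frame_hom (RR L) (CC L)"
    proof (rule frame_homI[OF R.complete_lattice_R C.complete_lattice_R])
      show "beta L I \<in> carrier (CC L)" if "I \<in> carrier (RR L)" for I
        using that by (simp add: R.round_R C.round_R beta_eq)
      show "beta L \<top>\<^bsub>RR L\<^esub> = \<top>\<^bsub>CC L\<^esub>"
        by (simp add: R.top_R C.top_R beta_eq R.round_ideal_carrier_set)
      show "beta L (I \<sqinter>\<^bsub>RR L\<^esub> J) = beta L I \<sqinter>\<^bsub>CC L\<^esub> beta L J"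
        if "I \<in> carrier (RR L)" "J \<in> carrier (RR L)" for I J
        using that
        by (simp add: R.meet_R C.meet_R R.round_R C.round_R beta_eq R.round_ideal_Int)
      show "beta L (\<Squnion>\<^bsub>RR L\<^esub>S) = \<Squnion>\<^bsub>CC L\<^esub>(beta L ` S)" if S: "S \<subseteq> carrier (RR L)" for S
      proof -
        have r: "\<And>I. I \<in> S \<Longrightarrow> round_ideal L I" using S by (auto simp: R.round_R)
        have "beta L ` S = S" using r by (simp add: beta_eq)
        moreover have "S \<subseteq> carrier (CC L)" using r by (auto simp: C.round_R)
        ultimately show ?thesis
          using S by (simp add: R.sup_R C.sup_R beta_eq R.ideal_join_round[OF r])
      qed
    qed
    show "beta L I \<prec>\<^bsub>CC L\<^esub> beta L J"
      if "I \<in> carrier (RR L)" "J \<in> carrier (RR L)" "I \<prec>\<^bsub>RR L\<^esub> J" for I J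
      using that C.prox_R_if_sup_mem[of I J]
      by (simp add: R.round_R C.round_R R.prox_RR beta_eq)
  qed
qed

lemma proximity_hom_beta: "proximity_frame L \<Longrightarrow> proximity_hom (RR L) (CC L) (beta L)"
  by (intro proximity_hom.intro proximity_hom_axioms.intro beta_prox_hom
      proximity_frame.proximity_frame_RR proximity_frame.proximity_frame_CC)

text \<open>This is not an identity law of the functor: \<open>X\<close> is round for
  \<open>RR L\<close>, while the image is formed with the proximity of \<open>CC L\<close>. Written
  with the order, the image no longer mentions either proximity, and it remains that
  \<open>X\<close> is a downset.\<close>

lemma RR_map_beta:
  assumes "proximity_frame L" "round_ideal (RR L) X"
  shows "RR_map (CC L) (beta L) X = X"
proof -
  interpret R: round_ideal_proximity L "RR L" by (rule round_ideal_proximity_RR[OF assms(1)])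
  interpret C: round_ideal_proximity L "CC L" by (rule round_ideal_proximity_CC[OF assms(1)])
  interpret b: proximity_hom "RR L" "CC L" "beta L" by (rule proximity_hom_beta[OF assms(1)])
  have X: "\<And>J. J \<in> X \<Longrightarrow> round_ideal L J"
    using b.round_ideal_memD[OF assms(2)] by (simp add: R.round_R)
  show ?thesis
    unfolding b.RR_map_eq[OF assms(2)]
    using b.round_ideal_down[OF assms(2)] X
    by (auto simp: C.round_R R.round_R C.le_R R.le_R beta_eq)
qed

lemma beta_beta_eq:
  assumes "proximity_frame L" "round_ideal (RR L) X"
  shows "beta_beta L X = X"
proof -
  interpret b: proximity_hom "RR L" "CC L" "beta L" by (rule proximity_hom_beta[OF assms(1)])
  show ?thesis
    \<comment> \<open>\<open>beta (CC L)\<close> is the identity only on ideals that are round for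
      \<open>CC L\<close>. Since \<open>X\<close> equals its image by \<open>RR_map_beta\<close>,
      roundness of that image supplies this.\<close>
    using b.RR_map_round[OF assms(2)]
    by (simp add: beta_beta_def RR_map_beta[OF assms] beta_eq)
qed

lemma beta_beta_prox_hom:
  assumes "proximity_frame L"
  shows "beta_beta L \<in> prox_hom (RR (RR L)) (CC (CC L))"
  unfolding beta_beta_def
  by (intro prox_hom_compose[OF RR_map_prox_hom_RR] proximity_hom_beta beta_prox_hom
      proximity_frame.proximity_frame_CC assms)

theorem corollary4p20:
  fixes L :: "'a pframe"
  assumes "proximity_frame L"
  shows
   "(proximity_frame (RR L) \<and>
     (\<forall>(M :: 'b pframe) f. proximity_frame M \<and> f \<in> prox_hom L M \<longrightarrow>
        RR_map M f \<in> prox_hom (RR L) (RR M)) \<and>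
     (\<forall>I\<in>carrier (RR L). RR_map L id I = I) \<and>
     (\<forall>(M :: 'b pframe) (N :: 'c pframe) f g.
        proximity_frame M \<and> proximity_frame N \<and> f \<in> prox_hom L M \<and> g \<in> prox_hom M N \<longrightarrow>
        (\<forall>I\<in>carrier (RR L). RR_map N (g \<circ> f) I = (RR_map N g \<circ> RR_map M f) I)) \<and>
     RR_counit L \<in> prox_hom (RR L) L \<and>
     RR_comult L \<in> prox_hom (RR L) (RR (RR L)) \<and>
     (\<forall>(M :: 'b pframe) f. proximity_frame M \<and> f \<in> prox_hom L M \<longrightarrow>
        (\<forall>I\<in>carrier (RR L).
           (RR_counit M \<circ> RR_map M f) I = (f \<circ> RR_counit L) I \<and>
           (RR_comult M \<circ> RR_map M f) I = (RR_map (RR M) (RR_map M f) \<circ> RR_comult L) I)) \<and>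
     (\<forall>I\<in>carrier (RR L).
        (RR_counit (RR L) \<circ> RR_comult L) I = I \<and>
        (RR_map L (RR_counit L) \<circ> RR_comult L) I = I \<and>
        (RR_comult (RR L) \<circ> RR_comult L) I = (RR_map (RR (RR L)) (RR_comult L) \<circ> RR_comult L) I))
  \<and>
    (proximity_frame (CC L) \<and>
     (\<forall>(M :: 'b pframe) f. proximity_frame M \<and> f \<in> prox_hom L M \<longrightarrow>
        CC_map M f \<in> prox_hom (CC L) (CC M)) \<and>
     (\<forall>I\<in>carrier (CC L). CC_map L id I = I) \<and>
     (\<forall>(M :: 'b pframe) (N :: 'c pframe) f g.
        proximity_frame M \<and> proximity_frame N \<and> f \<in> prox_hom L M \<and> g \<in> prox_hom M N \<longrightarrow>
        (\<forall>I\<in>carrier (CC L). CC_map N (g \<circ> f) I = (CC_map N g \<circ> CC_map M f) I)) \<and>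
     CC_counit L \<in> prox_hom (CC L) L \<and>
     CC_comult L \<in> prox_hom (CC L) (CC (CC L)) \<and>
     (\<forall>(M :: 'b pframe) f. proximity_frame M \<and> f \<in> prox_hom L M \<longrightarrow>
        (\<forall>I\<in>carrier (CC L).
           (CC_counit M \<circ> CC_map M f) I = (f \<circ> CC_counit L) I \<and>
           (CC_comult M \<circ> CC_map M f) I = (CC_map (CC M) (CC_map M f) \<circ> CC_comult L) I)) \<and>
     (\<forall>I\<in>carrier (CC L).
        (CC_counit (CC L) \<circ> CC_comult L) I = I \<and>
        (CC_map L (CC_counit L) \<circ> CC_comult L) I = I \<and>
        (CC_comult (CC L) \<circ> CC_comult L) I = (CC_map (CC (CC L)) (CC_comult L) \<circ> CC_comult L) I))
  \<and>
    (beta L \<in> prox_hom (RR L) (CC L) \<and>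
     bij_betw (beta L) (carrier (RR L)) (carrier (CC L)) \<and>
     (\<forall>(M :: 'b pframe) f. proximity_frame M \<and> f \<in> prox_hom L M \<longrightarrow>
        (\<forall>I\<in>carrier (RR L). (beta M \<circ> RR_map M f) I = (CC_map M f \<circ> beta L) I)))
  \<and>
    beta_beta L \<in> prox_hom (RR (RR L)) (CC (CC L))
  \<and>
    (\<forall>I\<in>carrier (RR L). (CC_comult L \<circ> beta L) I = (beta_beta L \<circ> RR_comult L) I)
  \<and>
    (\<forall>I\<in>carrier (RR L). (CC_counit L \<circ> beta L) I = RR_counit L I)"
proof -
  interpret proximity_frame L by fact
  interpret R: round_ideal_proximity L "RR L" by (rule round_ideal_proximity_RR[OF assms])
  interpret C: round_ideal_proximity L "CC L" by (rule round_ideal_proximity_CC[OF assms])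
  note RR_unfold = RR_counit_eq RR_comult_def o_apply carrier_RR mem_Collect_eq
  note CC_unfold = CC_counit_eq CC_comult_eq CC_map_eq o_apply carrier_CC mem_Collect_eq
  have hom: "proximity_hom L M f" if "proximity_frame M \<and> f \<in> prox_hom L M"
    for M :: "'d pframe" and f
    using that assms by (simp add: proximity_hom_def proximity_hom_axioms_def)
  have hom': "proximity_hom M N g"
    if "proximity_frame M" "proximity_frame N" "g \<in> prox_hom M N"
    for M :: "'b pframe" and N :: "'c pframe" and g
    using that by (simp add: proximity_hom_def proximity_hom_axioms_def)
  show ?thesis
  \<comment> \<open>Goals 1 to 11 are the functor and comonad laws for \<open>RR\<close> and 12 to
    22 the same for \<open>CC\<close>. Goals 23 to 25 say that \<open>beta\<close> is a bijective
    natural morphism, 26 that its square is a morphism, and 27 and 28 are the two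
    compatibilities.\<close>
  proof (intro conjI allI impI ballI, goal_cases)
    case 1 show ?case by (rule R.proximity_R)
  next
    case 2 then show ?case by (intro RR_map_prox_hom_RR hom)
  next
    case 3 then show ?case by (simp add: RR_map_id[OF assms] RR_unfold)
  next
    case 4 then show ?case by (simp add: RR_map_compose[OF hom hom'] RR_unfold)
  next
    case 5 show ?case unfolding RR_counit_eq by (rule R.counit_prox_hom)
  next
    case 6 show ?case unfolding RR_comult_def by (rule RR_comult_prox_hom[OF assms])
  next
    case 7 then show ?case by (simp add: RR_unfold proximity_hom.sup_RR_map[OF hom])
  next
    case (8 M f I)
    then show ?case
      using comult_natural[OF R.round_ideal_proximity_axioms round_ideal_proximity_RR hom
          RR_map_prox_hom_RR[OF hom], of M f I]
      by (simp add: RR_unfold)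
  next
    case 9 then show ?case by (simp add: RR_unfold R.sup_comult)
  next
    case 10 then show ?case by (simp add: RR_unfold R.RR_map_sup_comult)
  next
    case 11
    then show ?case
      using R.comult_coassoc[OF round_ideal_proximity_RR[OF R.proximity_R]
          RR_comult_prox_hom[OF assms]]
      by (simp add: RR_unfold)
  next
    case 12 show ?case by (rule C.proximity_R)
  next
    case 13 then show ?case unfolding CC_map_eq by (intro RR_map_prox_hom_CC hom)
  next
    case 14 then show ?case by (simp add: RR_map_id[OF assms] CC_unfold)
  next
    case 15 then show ?case by (simp add: RR_map_compose[OF hom hom'] CC_unfold)
  next
    case 16 show ?case unfolding CC_counit_eq by (rule C.counit_prox_hom)
  next
    case 17 show ?case unfolding CC_comult_eq by (rule CC_comult_prox_hom[OF assms])
  next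
    case 18 then show ?case by (simp add: CC_unfold proximity_hom.sup_RR_map[OF hom])
  next
    case (19 M f I)
    then show ?case
      using comult_natural[OF C.round_ideal_proximity_axioms round_ideal_proximity_CC hom
          RR_map_prox_hom_CC[OF hom], of M f I]
      by (simp add: CC_unfold)
  next
    case 20 then show ?case by (simp add: CC_unfold C.sup_comult)
  next
    case 21 then show ?case by (simp add: CC_unfold C.RR_map_sup_comult)
  next
    case 22
    then show ?case
      using C.comult_coassoc[OF round_ideal_proximity_CC[OF C.proximity_R]
          CC_comult_prox_hom[OF assms]]
      by (simp add: CC_unfold)
  next
    case 23 show ?case by (rule beta_prox_hom[OF assms])
  next
    case 24 show ?case by (auto simp: bij_betw_def inj_on_def beta_def RR_def CC_def)
  next
    case 25
    then show ?case
      by (simp add: CC_map_eq RR_unfold beta_eq proximity_hom.RR_map_round[OF hom])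
  next
    case 26 show ?case by (rule beta_beta_prox_hom[OF assms])
  next
    case 27
    then show ?case
      by (simp add: CC_comult_eq RR_unfold beta_eq beta_beta_eq[OF assms] R.comult_round)
        (simp add: R.comult_eq C.comult_eq)
  next
    case 28 then show ?case by (simp add: CC_counit_eq RR_unfold beta_eq)
  qed
qed

end
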